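(* Let $p$ be an odd prime, $x\in\mathbb Z_p$ and $x'=(x-\langle x\rangle_p)/p$. Put $T(x)=\dfrac{B_{p^2(p-1)}(-x)-B_{p^2(p-1)}}{p^2(p-1)}$. Then $$G_{p-1}(x)\equiv(-1)^{\langle x\rangle_p}\big(1-2pT(x)+2p^2T(x)^2\big)+p^2\big(x'(x'+1)+1\big)E_{p-3}(-x)\pmod{p^3}.$$ Consequently, for every prime $p>3$: $$G_{p-1}^{(3)}\equiv(-1)^{[p/3]}729^{p-1}+7p^2U_{p-3}\pmod{p^3},\quad G_{p-1}^{(6)}\equiv(-1)^{\frac{p-1}2}186624^{p-1}+\tfrac{155}9p^2E_{p-3}\pmod{p^3},$$ $$G_{p-1}^{(4)}\equiv(-1)^{[p/4]}4096^{p-1}+13p^2s_{p-3}\pmod{p^3}.$$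
   Context: For real $x$ and integer $k\ge0$, $\binom xk=x(x-1)\cdots(x-k+1)/k!$; $G_n(x)=\sum_{k=0}^n\binom nk(-1)^k\binom xk\binom{-1-x}k$. For a prime $p$, $\mathbb Z_p$ is the set of rationals with denominator prime to $p$; congruences modulo powers of $p$ are in $\mathbb Z_p$; for $x\in\mathbb Z_p$, $\langle x\rangle_p\in\{0,\ldots,p-1\}$ with $x\equiv\langle x\rangle_p\pmod p$. $[y]$ is the greatest integer $\le y$. Bernoulli numbers: $B_0=1$, $\sum_{k=0}^{n-1}\binom nkB_k=0$ ($n\ge2$); Bernoulli polynomials $B_n(x)=\sum_{k=0}^n\binom nkB_kx^{n-k}$. Euler numbers: $E_{2n-1}=0$, $E_0=1$, $E_{2n}=-\sum_{k=1}^n\binom{2n}{2k}E_{2n-2k}$; Euler polynomials $E_n(x)=2^{-n}\sum_{k=0}^n\binom nk(2x-1)^{n-k}E_k$. $U_{2n-1}=0$, $U_0=1$, $U_{2n}=-2\sum_{k=1}^n\binom{2n}{2k}U_{2n-2k}$. $s_0=1$, $s_n=1-\sum_{k=0}^{n-1}\binom nk2^{2n-1-2k}s_k$ ($n\ge1$). $G_n^{(3)}=27^nG_n(-\tfrac13)$, $G_n^{(4)}=64^nG_n(-\tfrac14)$, $G_n^{(6)}=432^nG_n(-\tfrac16)$.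
   Formalization: The first congruence is stated for primes p > 3 rather than all odd primes, because it is false for p = 3: at x = 0 the left side is 1 and the right side is 10, and 27 does not divide 9. *)

theory Defs
  imports Complex_Main "HOL-Computational_Algebra.Primes"
begin

definition G :: "nat \<Rightarrow> 'a::field_char_0 \<Rightarrow> 'a" where
  "G n x = (\<Sum>k=0..n. of_nat (n choose k) * (-1) ^ k * (x gchoose k) * ((-1 - x) gchoose k))"

definition G3 :: "nat \<Rightarrow> rat" where "G3 n = 27 ^ n * G n (-1/3)"
definition G4 :: "nat \<Rightarrow> rat" where "G4 n = 64 ^ n * G n (-1/4)"
definition G6 :: "nat \<Rightarrow> rat" where "G6 n = 432 ^ n * G n (-1/6)"

text \<open>The rationals whose (reduced) denominator is prime to \<open>p\<close>.\<close>
definition Zp :: "nat \<Rightarrow> rat set" where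
  "Zp p = {x. coprime (snd (quotient_of x)) (int p)}"

definition zp_cong :: "nat \<Rightarrow> nat \<Rightarrow> rat \<Rightarrow> rat \<Rightarrow> bool" where
  "zp_cong p m a b \<longleftrightarrow> a \<in> Zp p \<and> b \<in> Zp p \<and> (\<exists>c \<in> Zp p. a - b = of_nat p ^ m * c)"

text \<open>The least non-negative residue; well defined for prime \<open>p\<close> and \<open>x \<in> Zp p\<close>.\<close>
definition zp_res :: "nat \<Rightarrow> rat \<Rightarrow> nat" where
  "zp_res p x = (THE r. r < p \<and> zp_cong p 1 x (of_nat r))"

text \<open>
  The recursion \<open>\<Sum>k<n. (n choose k) * B k = 0\<close> for \<open>n \<ge> 2\<close>, solved for its last term \<open>B (n - 1)\<close>
  (see \<open>bernoulli_num_sum\<close> below).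
\<close>
fun bernoulli_num :: "nat \<Rightarrow> rat" where
  "bernoulli_num n = (if n = 0 then 1
     else - (\<Sum>k<n. of_nat (Suc n choose k) * bernoulli_num k) / of_nat (Suc n))"
declare bernoulli_num.simps [simp del]

lemma bernoulli_num_0: "bernoulli_num 0 = 1"
  by (simp add: bernoulli_num.simps)

lemma bernoulli_num_sum:
  assumes "n \<ge> 2"
  shows "(\<Sum>k=0..n-1. of_nat (n choose k) * bernoulli_num k) = 0"
proof -
  obtain m where n: "n = Suc m" "m \<noteq> 0" using assms by (cases n) auto
  have eq: "{0..n-1} = insert m {..<m}" using n by auto
  show ?thesis unfolding eq using n bernoulli_num.simps[of m]
    by (simp add: field_simps del: of_nat_Suc)
qed

definition bernoulli_poly :: "nat \<Rightarrow> rat \<Rightarrow> rat" where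
  "bernoulli_poly n x = (\<Sum>k=0..n. of_nat (n choose k) * bernoulli_num k * x ^ (n - k))"

text \<open>Written at index \<open>m = 2n\<close>; the odd-indexed values vanish. The same convention is used for \<open>U_num\<close>.\<close>
fun euler_num :: "nat \<Rightarrow> int" where
  "euler_num m = (if m = 0 then 1 else if odd m then 0
     else - (\<Sum>k=1..m div 2. int (m choose (2*k)) * euler_num (m - 2*k)))"
declare euler_num.simps [simp del]

definition euler_poly :: "nat \<Rightarrow> rat \<Rightarrow> rat" where
  "euler_poly n x =
     (\<Sum>k=0..n. of_nat (n choose k) * (2*x - 1) ^ (n - k) * of_int (euler_num k)) / 2 ^ n"

fun U_num :: "nat \<Rightarrow> int" where
  "U_num m = (if m = 0 then 1 else if odd m then 0
     else - 2 * (\<Sum>k=1..m div 2. int (m choose (2*k)) * U_num (m - 2*k)))"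
declare U_num.simps [simp del]

fun s_num :: "nat \<Rightarrow> int" where
  "s_num n = (if n = 0 then 1
     else 1 - (\<Sum>k<n. int (n choose k) * 2 ^ (2*n - 1 - 2*k) * s_num k))"
declare s_num.simps [simp del]

definition T_quot :: "nat \<Rightarrow> rat \<Rightarrow> rat" where
  "T_quot p x = (bernoulli_poly (p^2 * (p - 1)) (-x) - bernoulli_num (p^2 * (p - 1)))
                / of_nat (p^2 * (p - 1))"

end

theory Submission
  imports Defs "HOL-Computational_Algebra.Computational_Algebra" "HOL-Number_Theory.Number_Theory"
begin

text \<open>
  The polynomial \<open>G n\<close> satisfies a three-term recurrence in \<open>x\<close>, by which
  \<open>D x = x\<^sup>2 (G (p - 1) x + G (p - 1) (x - 1))\<close> has the difference
  \<open>D (x + 1) - D x = 2 p (2 x + 1) G (p - 1) x\<close>. Starting from \<open>G (p - 1) y \<equiv> 1\<close> modulo \<open>p ^ 3\<close> for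
  \<open>p\<close> dividing \<open>y\<close> (Wolstenholme), one sums up along \<open>y, y + 1, \<dots>, y + r = x\<close>, and \<open>G (p - 1) x\<close> is
  expressed by the sums of \<open>1 / x\<^sub>j\<close> and \<open>(-1) ^ j / x\<^sub>j\<^sup>2\<close> with \<open>x\<^sub>j = y + j\<close>. As
  \<open>1 / x\<^sub>j \<equiv> x\<^sub>j ^ (N - 1)\<close> for \<open>N = p\<^sup>2 (p - 1)\<close> and \<open>1 / x\<^sub>j\<^sup>2 \<equiv> x\<^sub>j ^ (p - 3)\<close>, these sums telescope to
  values of Bernoulli and Euler polynomials.

  For \<open>x = - 1 / m\<close> the multiplication theorem turns \<open>T\<close> into Fermat quotients, so that
  \<open>1 - 2 p T + 2 p\<^sup>2 T\<^sup>2\<close>, the truncated exponential of \<open>- 2 p T\<close>, becomes a \<open>(p - 1)\<close>-st power.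
\<close>

subsection \<open>p-adic integers among the rationals\<close>

text \<open>The three-term recurrence of \<open>G n\<close> has the middle coefficient
  \<open>(2 * x + 1) * (2 * n + 1)\<close>. For \<open>n = p - 1\<close> it is
  \<open>(2 * x + 1) * (2 * p - 1)\<close>: up to a multiple of \<open>p\<close> it is
  \<open>- (2 * x + 1) = x^2 - (x + 1)^2\<close>, which is why the sum of neighbours in
  \<open>D\<close> is almost constant. The factor \<open>p\<close> in the difference of
  \<open>D\<close> also means that \<open>G\<close> modulo \<open>p^2\<close> determines the next
  \<open>D\<close> modulo \<open>p^3\<close>; no precision is lost along the progression. The
  obstacle is precision in \<open>T\<close>: its denominator contains \<open>p^2\<close>, and
  \<open>bernoulli_num N\<close> has a further \<open>p\<close> in its denominator. At
  \<open>- 1 / m\<close> the numerator is \<open>bernoulli_num N\<close> times a combination of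
  quantities \<open>1 - a^(-N)\<close>. These are divisible by \<open>p^3\<close>, but have to be
  known modulo \<open>p^5\<close>. The constants: the exponentials are the (p-1)-st powers of
  \<open>27 = 3^3\<close>, \<open>64 = 2^6\<close>, \<open>432 = 2^4 * 3^3\<close>. These are also
  the scaling factors of \<open>G3\<close>, \<open>G4\<close>, \<open>G6\<close>, so 729, 4096,
  186624 are their squares. With \<open>x' = - j / m\<close>, the factor
  \<open>x' * (x' + 1) + 1\<close> equals 7/9, 13/16, 31/36 for m = 3, 4, 6.\<close>

lemma Zp_iff:
  "x \<in> Zp p \<longleftrightarrow> (\<exists>a b. b \<noteq> 0 \<and> coprime b (int p) \<and> x = of_int a / of_int b)"
proof
  assume x: "x \<in> Zp p"
  obtain a b where ab: "quotient_of x = (a, b)" by force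
  have "b > 0" using quotient_of_denom_pos[OF ab] .
  moreover have "coprime b (int p)" using x ab by (simp add: Zp_def)
  ultimately show "\<exists>a b. b \<noteq> 0 \<and> coprime b (int p) \<and> x = of_int a / of_int b"
    using quotient_of_div[OF ab] by (intro exI[of _ a] exI[of _ b]) simp
next
  assume "\<exists>a b. b \<noteq> 0 \<and> coprime b (int p) \<and> x = of_int a / of_int b"
  then obtain a b where b: "b \<noteq> 0" "coprime b (int p)" and x: "x = of_int a / of_int b"
    by blast
  obtain c d where cd: "quotient_of x = (c, d)" by force
  have d: "d > 0" using quotient_of_denom_pos[OF cd] .
  have "(of_int (a * d) :: rat) = of_int (c * b)"
    using quotient_of_div[OF cd] x b d by (simp add: field_simps)
  then have "a * d = c * b" by (simp only: of_int_eq_iff)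
  then have "d dvd c * b" by (metis dvd_triv_right)
  then have "d dvd b" using quotient_of_coprime[OF cd]
    by (simp add: coprime_commute coprime_dvd_mult_right_iff)
  then have "coprime d (int p)" using b(2) by (metis coprime_divisors dvd_refl)
  then show "x \<in> Zp p" using cd by (simp add: Zp_def)
qed

lemma Zp_of_int [simp]: "of_int a \<in> Zp p"
  unfolding Zp_iff by (rule exI[of _ a], rule exI[of _ 1]) simp

lemma Zp_of_nat [simp]: "of_nat a \<in> Zp p"
  using Zp_of_int[of "int a"] by simp

lemma Zp_0 [simp]: "0 \<in> Zp p" and Zp_1 [simp]: "1 \<in> Zp p"
  and Zp_numeral [simp]: "numeral w \<in> Zp p"
  using Zp_of_int[of 0] Zp_of_int[of 1] Zp_of_int[of "numeral w"] by simp_all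

lemma Zp_uminus [simp]: "- x \<in> Zp p \<longleftrightarrow> x \<in> Zp p"
proof -
  have "- x \<in> Zp p" if "x \<in> Zp p" for x
    using that unfolding Zp_iff by (metis minus_divide_left of_int_minus)
  then show ?thesis by force
qed

lemma Zp_add [simp, intro]:
  assumes "x \<in> Zp p" "y \<in> Zp p" shows "x + y \<in> Zp p"
proof -
  obtain a b c d where "b \<noteq> 0" "coprime b (int p)" "x = of_int a / of_int b"
    "d \<noteq> 0" "coprime d (int p)" "y = of_int c / of_int d"
    using assms unfolding Zp_iff by blast
  then have "b * d \<noteq> 0" "coprime (b * d) (int p)"
    "x + y = of_int (a * d + c * b) / of_int (b * d)" by (auto simp: field_simps)
  then show ?thesis unfolding Zp_iff by blast
qed

lemma Zp_mult [simp, intro]: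
  assumes "x \<in> Zp p" "y \<in> Zp p" shows "x * y \<in> Zp p"
proof -
  obtain a b c d where "b \<noteq> 0" "coprime b (int p)" "x = of_int a / of_int b"
    "d \<noteq> 0" "coprime d (int p)" "y = of_int c / of_int d"
    using assms unfolding Zp_iff by blast
  then have "b * d \<noteq> 0" "coprime (b * d) (int p)"
    "x * y = of_int (a * c) / of_int (b * d)" by (auto simp: field_simps)
  then show ?thesis unfolding Zp_iff by blast
qed

lemma Zp_diff [simp, intro]: "x \<in> Zp p \<Longrightarrow> y \<in> Zp p \<Longrightarrow> x - y \<in> Zp p"
  using Zp_add[of x p "- y"] by simp

lemma Zp_power [simp, intro]: "x \<in> Zp p \<Longrightarrow> x ^ n \<in> Zp p"
  by (induction n) auto

lemma Zp_sum [intro]: "(\<And>i. i \<in> A \<Longrightarrow> f i \<in> Zp p) \<Longrightarrow> sum f A \<in> Zp p"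
  by (induction A rule: infinite_finite_induct) auto

text \<open>The p-adic valuation of \<open>x\<close> is at least \<open>m\<close>. Congruences are
  treated as \<open>pdiv\<close> of a difference, which makes sense for any rationals and so
  postpones the membership conditions built into \<open>zp_cong\<close>.\<close>

definition pdiv :: "nat \<Rightarrow> nat \<Rightarrow> rat \<Rightarrow> bool" where
  "pdiv p m x \<longleftrightarrow> (\<exists>c\<in>Zp p. x = of_nat p ^ m * c)"

lemma zp_cong_iff: "zp_cong p m a b \<longleftrightarrow> b \<in> Zp p \<and> pdiv p m (a - b)"
proof -
  have "a \<in> Zp p" if "b \<in> Zp p" "c \<in> Zp p" "a - b = of_nat p ^ m * c" for c
  proof -
    have "b + of_nat p ^ m * c \<in> Zp p" using that(1,2) by simp
    then show ?thesis using that(3) by (metis add.commute diff_add_cancel)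
  qed
  then show ?thesis unfolding zp_cong_def pdiv_def by blast
qed

lemma pdiv_0 [simp]: "pdiv p m 0"
  unfolding pdiv_def by (rule bexI[of _ 0]) auto

lemma pdivI: "c \<in> Zp p \<Longrightarrow> pdiv p m (of_nat p ^ m * c)"
  unfolding pdiv_def by blast

lemma pdiv_p: "c \<in> Zp p \<Longrightarrow> pdiv p 1 (of_nat p * c)"
  using pdivI[of c p 1] by simp

lemma pdiv_0_iff: "pdiv p 0 x \<longleftrightarrow> x \<in> Zp p"
  unfolding pdiv_def by auto

lemma pdiv_add: "pdiv p m x \<Longrightarrow> pdiv p m y \<Longrightarrow> pdiv p m (x + y)"
  unfolding pdiv_def by (metis Zp_add distrib_left)

lemma pdiv_uminus_iff: "pdiv p m (- x) \<longleftrightarrow> pdiv p m x"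
  unfolding pdiv_def by (metis Zp_uminus minus_minus mult_minus_right)

lemma pdiv_diff: "pdiv p m x \<Longrightarrow> pdiv p m y \<Longrightarrow> pdiv p m (x - y)"
  using pdiv_add[of p m x "- y"] by (simp add: pdiv_uminus_iff)

lemma pdiv_sym: "pdiv p m (x - y) \<Longrightarrow> pdiv p m (y - x)"
  using pdiv_uminus_iff[of p m "x - y"] by simp

lemma pdiv_trans: "pdiv p m (x - y) \<Longrightarrow> pdiv p m (y - z) \<Longrightarrow> pdiv p m (x - z)"
  using pdiv_add[of p m "x - y" "y - z"] by simp

lemma pdiv_mult: "pdiv p m x \<Longrightarrow> pdiv p n y \<Longrightarrow> pdiv p (m + n) (x * y)"
  unfolding pdiv_def by (auto simp: power_add)

lemma pdiv_scale: "pdiv p m x \<Longrightarrow> c \<in> Zp p \<Longrightarrow> pdiv p m (c * x)"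
  using pdiv_mult[of p 0 c m x] by (simp add: pdiv_0_iff)

lemma pdiv_scale_right: "pdiv p m x \<Longrightarrow> c \<in> Zp p \<Longrightarrow> pdiv p m (x * c)"
  using pdiv_scale[of p m x c] by (simp add: mult.commute[of x])

lemma pdiv_mono:
  assumes "pdiv p n x" "m \<le> n"
  shows "pdiv p m x"
proof -
  obtain c where c: "c \<in> Zp p" "x = of_nat p ^ n * c" using assms(1) unfolding pdiv_def by blast
  have "x = of_nat p ^ m * (of_nat p ^ (n - m) * c)"
    using c(2) assms(2) by (simp add: mult.assoc [symmetric] power_add [symmetric])
  then show ?thesis using pdivI[of "of_nat p ^ (n - m) * c" p m] c(1) by simp
qed

lemma pdiv_Zp: "pdiv p m x \<Longrightarrow> x \<in> Zp p"
  using pdiv_mono[of p m x 0] by (simp add: pdiv_0_iff)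

lemma pdiv_sum: "(\<And>i. i \<in> A \<Longrightarrow> pdiv p m (f i)) \<Longrightarrow> pdiv p m (sum f A)"
  by (induction A rule: infinite_finite_induct) (auto intro: pdiv_add)

lemma pdiv_cancel: "p > 0 \<Longrightarrow> pdiv p (m + n) (of_nat p ^ m * x) \<longleftrightarrow> pdiv p n x"
  unfolding pdiv_def by (auto simp: power_add)

lemma pdiv_div: "p > 0 \<Longrightarrow> pdiv p (n + m) x \<Longrightarrow> pdiv p n (x / of_nat p ^ m)"
  using pdiv_cancel[of p m n "x / of_nat p ^ m"] by (simp add: add.commute)

lemma pdiv_power: "pdiv p 1 x \<Longrightarrow> pdiv p n (x ^ n)"
proof (induction n)
  case (Suc n)
  then show ?case using pdiv_mult[of p 1 x n "x ^ n"] by simp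
qed (simp add: pdiv_0_iff)

lemma pdiv_mult_cong:
  assumes "pdiv p m (a - a')" "pdiv p m (b - b')" "b \<in> Zp p" "a' \<in> Zp p"
  shows "pdiv p m (a * b - a' * b')"
proof -
  have "a * b - a' * b' = (a - a') * b + a' * (b - b')" by (simp add: algebra_simps)
  then show ?thesis using assms by (simp add: pdiv_add pdiv_scale pdiv_scale_right)
qed

lemma pdiv_power_cong:
  assumes "pdiv p m (a - b)" "a \<in> Zp p" "b \<in> Zp p"
  shows "pdiv p m (a ^ n - b ^ n)"
  by (induction n) (use assms in \<open>auto intro: pdiv_mult_cong\<close>)

context
  fixes p :: nat
  assumes p: "prime p"
begin

lemma pdiv_of_int_iff: "pdiv p 1 (of_int n) \<longleftrightarrow> int p dvd n"
proof
  assume "pdiv p 1 (of_int n)"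
  then obtain c where c: "c \<in> Zp p" "(of_int n :: rat) = of_nat p * c"
    unfolding pdiv_def by auto
  obtain a b where ab: "b \<noteq> 0" "coprime b (int p)" "c = of_int a / of_int b"
    using c(1) unfolding Zp_iff by blast
  then have "(of_int (n * b) :: rat) = of_int (int p * a)" using c(2) by (simp add: field_simps)
  then have "n * b = int p * a" by (simp only: of_int_eq_iff)
  then have "int p dvd n * b" by simp
  then show "int p dvd n" using ab(2) by (metis coprime_commute coprime_dvd_mult_left_iff)
next
  assume "int p dvd n"
  then obtain k where "n = int p * k" by blast
  then show "pdiv p 1 (of_int n)" using pdiv_p[of "of_int k"] by simp
qed

lemma pdiv_of_nat_iff: "pdiv p 1 (of_nat n) \<longleftrightarrow> p dvd n"
  using pdiv_of_int_iff[of "int n"] by simp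

lemma Zp_inverse:
  assumes "x \<in> Zp p" "\<not> pdiv p 1 x"
  shows "1 / x \<in> Zp p"
proof -
  obtain a b where ab: "b \<noteq> 0" "coprime b (int p)" "x = of_int a / of_int b"
    using assms(1) unfolding Zp_iff by blast
  have b: "1 / of_int b \<in> Zp p" unfolding Zp_iff using ab by (intro exI[of _ 1] exI[of _ b]) auto
  have "\<not> int p dvd a"
  proof
    assume "int p dvd a"
    then have "pdiv p 1 (of_int a)" by (simp only: pdiv_of_int_iff)
    then have "pdiv p 1 (of_int a * (1 / of_int b))" using b by (rule pdiv_scale_right)
    then show False using assms ab by simp
  qed
  then have "coprime (int p) a" "a \<noteq> 0" using p
    by (auto intro: prime_imp_coprime)
  then have "coprime a (int p)" "a \<noteq> 0" by (simp_all add: coprime_commute)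
  moreover have "1 / x = of_int b / of_int a" using ab by simp
  ultimately show ?thesis unfolding Zp_iff by blast
qed

lemma Zp_inverse_of_nat: "\<not> p dvd n \<Longrightarrow> 1 / of_nat n \<in> Zp p"
  using Zp_inverse[of "of_nat n"] pdiv_of_nat_iff by simp

lemma zp_res_exists:
  assumes "x \<in> Zp p"
  shows "\<exists>r<p. pdiv p 1 (x - of_nat r)"
proof -
  obtain a b where ab: "b \<noteq> 0" "coprime b (int p)" "x = of_int a / of_int b"
    using assms unfolding Zp_iff by blast
  obtain c where c: "[b * c = a] (mod int p)"
    using ab(2) cong_solve_coprime_int[of b "int p"] by (metis cong_scalar_right mult.assoc mult_1)
  define r where "r = nat (c mod int p)"
  have r: "r < p" "[c = int r] (mod int p)"
    using prime_gt_0_nat[OF p] by (auto simp: r_def cong_def nat_less_iff)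
  have "[b * int r = a] (mod int p)" using r(2) c
    by (metis cong_scalar_left cong_sym cong_trans)
  then have "int p dvd a - b * int r" by (metis cong_iff_dvd_diff cong_sym)
  then have d: "pdiv p 1 (of_int (a - b * int r))" by (simp only: pdiv_of_int_iff)
  have b: "1 / of_int b \<in> Zp p" unfolding Zp_iff using ab by (intro exI[of _ 1] exI[of _ b]) auto
  have "x - of_nat r = of_int (a - b * int r) * (1 / of_int b)"
    using ab by (simp add: field_simps)
  then have "pdiv p 1 (x - of_nat r)" using pdiv_scale_right[OF d b] by simp
  then show ?thesis using r by blast
qed

lemma zp_res_eqI:
  assumes "r < p" "pdiv p 1 (x - of_nat r)"
  shows "zp_res p x = r"
  unfolding zp_res_def
proof (rule the_equality)
  show "r < p \<and> zp_cong p 1 x (of_nat r)" using assms by (simp add: zp_cong_iff)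
next
  fix s assume s: "s < p \<and> zp_cong p 1 x (of_nat s)"
  then have "pdiv p 1 (x - of_nat s)" by (simp add: zp_cong_iff)
  then have "pdiv p 1 (of_nat s - of_nat r)" using assms(2) pdiv_sym pdiv_trans by blast
  then have "pdiv p 1 (of_int (int s - int r))" by simp
  then have "int p dvd int s - int r" by (simp only: pdiv_of_int_iff)
  then have "[s = r] (mod p)" by (metis cong_iff_dvd_diff cong_int_iff)
  then show "s = r" using s assms(1) by (simp add: cong_less_modulus_unique_nat)
qed

lemma zp_res:
  assumes "x \<in> Zp p"
  shows "zp_res p x < p" "pdiv p 1 (x - of_nat (zp_res p x))"
  using zp_res_exists[OF assms] zp_res_eqI by auto

lemma fermat_Zp:
  assumes "x \<in> Zp p" "\<not> pdiv p 1 x"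
  shows "pdiv p 1 (x ^ (p - 1) - 1)"
proof -
  define r where "r = zp_res p x"
  have r: "pdiv p 1 (x - of_nat r)" using zp_res assms by (simp add: r_def)
  have "\<not> p dvd r"
  proof
    assume "p dvd r"
    then have "pdiv p 1 (x - of_nat r + of_nat r)" using r pdiv_add pdiv_of_nat_iff by blast
    then show False using assms by simp
  qed
  then have "[r ^ (p - 1) = 1] (mod p)" using fermat_theorem p by blast
  then have "int p dvd int (r ^ (p - 1)) - 1"
    by (metis cong_iff_dvd_diff cong_int_iff of_nat_1)
  then have "pdiv p 1 (of_int (int (r ^ (p - 1)) - 1))" by (simp only: pdiv_of_int_iff)
  then have "pdiv p 1 (of_nat r ^ (p - 1) - 1)" by simp
  moreover have "pdiv p 1 (x ^ (p - 1) - of_nat r ^ (p - 1))"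
    using r assms by (simp add: pdiv_power_cong)
  ultimately show ?thesis using pdiv_trans by blast
qed

text \<open>In \<open>a ^ p - 1 = (a - 1) * (\<Sum>i<p. a ^ i)\<close> the second factor is a sum of
  \<open>p\<close> terms congruent to 1, so it contributes one more factor \<open>p\<close>.\<close>

lemma pdiv_Suc_power_p:
  assumes "pdiv p (Suc m) (a - 1)"
  shows "pdiv p (Suc (Suc m)) (a ^ p - 1)"
proof -
  have a: "a \<in> Zp p" using pdiv_Zp[OF assms] Zp_add[of "a - 1" p 1] by simp
  have "pdiv p 1 (a ^ i - 1)" for i
    using pdiv_power_cong[OF assms a, of i] pdiv_mono[of p "Suc m" _ 1] by simp
  then have "pdiv p 1 (\<Sum>i<p. a ^ i - 1)" by (intro pdiv_sum)
  then have "pdiv p 1 ((\<Sum>i<p. a ^ i) - of_nat p)" by (simp add: sum_subtractf)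
  from pdiv_add[OF this pdiv_p[of 1]] have "pdiv p 1 (\<Sum>i<p. a ^ i)" by simp
  from pdiv_mult[OF assms this] show ?thesis
    by (simp add: power_diff_1_eq)
qed

text \<open>Fermat's congruence, raised twice to the p-th power; each time one factor
  \<open>p\<close> is gained.\<close>

lemma euler_Zp:
  assumes "x \<in> Zp p" "\<not> pdiv p 1 x"
  shows "pdiv p 3 (x ^ (p\<^sup>2 * (p - 1)) - 1)"
proof -
  have "pdiv p (Suc (Suc (Suc 0))) (((x ^ (p - 1)) ^ p) ^ p - 1)"
    using fermat_Zp[OF assms] by (intro pdiv_Suc_power_p) simp
  moreover have "((x ^ (p - 1)) ^ p) ^ p = x ^ (p\<^sup>2 * (p - 1))"
    by (simp add: power_mult [symmetric] power2_eq_square mult_ac)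
  ultimately show ?thesis by (simp add: numeral_3_eq_3)
qed

end

subsection \<open>The recurrence of G and Wolstenholme congruences\<close>

text \<open>This is the product of the binomial coefficients of \<open>x\<close> over
  \<open>k\<close> and of \<open>x + k\<close> over \<open>k\<close>; the form with
  \<open>-1 - x\<close> makes the symmetry under \<open>x\<close> to \<open>-1 - x\<close>
  visible.\<close>

definition gterm :: "nat \<Rightarrow> 'a::field_char_0 \<Rightarrow> 'a" where
  "gterm k x = (-1) ^ k * (x gchoose k) * ((-1 - x) gchoose k)"

lemma gterm_0 [simp]: "gterm 0 x = 1"
  by (simp add: gterm_def)

lemma gterm_Suc:
  "(of_nat k + 1)\<^sup>2 * gterm (Suc k) x = gterm k x * ((x - of_nat k) * (x + 1 + of_nat k))"
proof -
  have *: "(of_nat k + 1) * (a gchoose Suc k) = (a - of_nat k) * (a gchoose k)" for a :: 'a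
    using gbinomial_mult_1[of a k] by (simp add: algebra_simps)
  have "(of_nat k + 1)\<^sup>2 * gterm (Suc k) x
      = - ((-1) ^ k) * ((of_nat k + 1) * (x gchoose Suc k)) * ((of_nat k + 1) * ((-1 - x) gchoose Suc k))"
    by (simp add: gterm_def power2_eq_square)
  also have "\<dots> = gterm k x * ((x - of_nat k) * (x + 1 + of_nat k))"
    unfolding * gterm_def by (simp add: algebra_simps)
  finally show ?thesis .
qed

lemma gterm_reflect: "gterm k (-1 - x) = gterm k x"
  by (simp add: gterm_def)

text \<open>Up to factorials, \<open>gterm k x\<close> is the product of the \<open>2 * k\<close>
  consecutive numbers from \<open>x - k + 1\<close> to \<open>x + k\<close>. Shifting
  \<open>x\<close> and raising \<open>k\<close> extends this range only at the upper end, by two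
  factors. The induction on \<open>k\<close> proves this without dividing by a factor that may
  vanish.\<close>

lemma gterm_Suc_shift:
  "(of_nat k + 1)\<^sup>2 * gterm (Suc k) (x + 1)
     = gterm k x * ((x + 1 + of_nat k) * (x + 2 + of_nat k))"
proof (induction k)
  case 0
  then show ?case using gterm_Suc[of 0 "x + 1"] by (simp add: algebra_simps)
next
  case (Suc k)
  define m :: 'a where "m = of_nat k"
  have m: "m + 1 \<noteq> 0" using of_nat_neq_0[of k] by (simp add: m_def add.commute)
  have e: "(m + 2)\<^sup>2 * gterm (Suc (Suc k)) (x + 1) = gterm (Suc k) (x + 1) * ((x - m) * (x + m + 3))"
    using gterm_Suc[of "Suc k" "x + 1"] by (simp add: m_def algebra_simps)
  have e': "(m + 1)\<^sup>2 * gterm (Suc k) x = gterm k x * ((x - m) * (x + 1 + m))"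
    using gterm_Suc[of k x] by (simp add: m_def)
  have "(m + 1)\<^sup>2 * ((m + 2)\<^sup>2 * gterm (Suc (Suc k)) (x + 1))
      = ((m + 1)\<^sup>2 * gterm (Suc k) (x + 1)) * ((x - m) * (x + m + 3))"
    unfolding e by (simp only: mult.assoc)
  also have "\<dots> = gterm k x * ((x + 1 + m) * (x + 2 + m)) * ((x - m) * (x + m + 3))"
    using Suc by (simp add: m_def)
  also have "\<dots> = (gterm k x * ((x - m) * (x + 1 + m))) * ((x + m + 2) * (x + m + 3))"
    by (simp add: algebra_simps)
  also have "\<dots> = (m + 1)\<^sup>2 * (gterm (Suc k) x * ((x + m + 2) * (x + m + 3)))"
    unfolding e' [symmetric] by (simp only: mult.assoc)
  finally have "(m + 2)\<^sup>2 * gterm (Suc (Suc k)) (x + 1)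
      = gterm (Suc k) x * ((x + m + 2) * (x + m + 3))" using m by simp
  then show ?case by (simp add: m_def algebra_simps)
qed

lemma gterm_Suc_shift_minus:
  "(of_nat k + 1)\<^sup>2 * gterm (Suc k) (x - 1)
     = gterm k x * ((x - of_nat k) * (x - 1 - of_nat k))"
proof -
  have "gterm (Suc k) (x - 1) = gterm (Suc k) ((-1 - x) + 1)"
    using gterm_reflect[of "Suc k" "x - 1"] by simp
  then show ?thesis using gterm_Suc_shift[of k "-1 - x"] gterm_reflect[of k x]
    by (simp add: algebra_simps)
qed

text \<open>For \<open>k > 0\<close> every term is a polynomial multiple of
  \<open>gterm (k - 1) x\<close>, so this is a polynomial identity. For \<open>k = 0\<close> the
  truncated index \<open>k - 1\<close> is harmless, as its coefficient vanishes.\<close>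

lemma gterm_recurrence:
  "(x + 1)\<^sup>2 * gterm k (x + 1) - x\<^sup>2 * gterm k (x - 1)
     = (2 * x + 1) * ((2 * of_nat k + 1) * gterm k x + 2 * of_nat k * gterm (k - 1) x)"
proof (cases k)
  case 0
  then show ?thesis by (simp add: power2_eq_square algebra_simps)
next
  case (Suc j)
  define m :: 'a where "m = of_nat j"
  have m: "m + 1 \<noteq> 0" using of_nat_neq_0[of j] by (simp add: m_def add.commute)
  define g where "g = gterm j x"
  have e: "(m + 1)\<^sup>2 * gterm (Suc j) (x + 1) = g * ((x + 1 + m) * (x + 2 + m))"
    "(m + 1)\<^sup>2 * gterm (Suc j) (x - 1) = g * ((x - m) * (x - 1 - m))"
    "(m + 1)\<^sup>2 * gterm (Suc j) x = g * ((x - m) * (x + 1 + m))"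
    using gterm_Suc_shift[of j x] gterm_Suc_shift_minus[of j x] gterm_Suc[of j x]
    by (simp_all add: m_def g_def)
  have "(m + 1)\<^sup>2 * ((x + 1)\<^sup>2 * gterm (Suc j) (x + 1) - x\<^sup>2 * gterm (Suc j) (x - 1))
      = (x + 1)\<^sup>2 * ((m + 1)\<^sup>2 * gterm (Suc j) (x + 1)) - x\<^sup>2 * ((m + 1)\<^sup>2 * gterm (Suc j) (x - 1))"
    by (simp add: algebra_simps)
  also have "\<dots> = (2 * x + 1) * ((2 * m + 3) * (g * ((x - m) * (x + 1 + m))) + 2 * (m + 1) * (m + 1)\<^sup>2 * g)"
    unfolding e by (simp add: power2_eq_square algebra_simps)
  also have "\<dots> = (m + 1)\<^sup>2 * ((2 * x + 1) * ((2 * m + 3) * gterm (Suc j) x + 2 * (m + 1) * g))"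
    unfolding e(3) [symmetric] by (simp add: algebra_simps)
  finally have "(x + 1)\<^sup>2 * gterm (Suc j) (x + 1) - x\<^sup>2 * gterm (Suc j) (x - 1)
      = (2 * x + 1) * ((2 * m + 3) * gterm (Suc j) x + 2 * (m + 1) * g)" using m by simp
  then show ?thesis using Suc by (simp add: m_def g_def algebra_simps)
qed

lemma G_altdef: "G n x = (\<Sum>k\<le>n. of_nat (n choose k) * gterm k x)"
  unfolding G_def gterm_def atLeast0AtMost by (simp add: mult_ac)

lemma G_reflect: "G n (-1 - x) = G n x"
  by (simp add: G_altdef gterm_reflect)

lemma G_0 [simp]: "G n 0 = 1"
proof -
  have *: "gterm k (0 :: 'a) = (if k = 0 then 1 else 0)" for k
    by (cases k) (auto simp: gterm_def)
  show ?thesis unfolding G_altdef * by (simp add: if_distrib cong: if_cong)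
qed

text \<open>After summation against \<open>n choose k\<close>, absorption moves the lower-index term
  to weight \<open>2 * (n - k)\<close> at index \<open>k\<close>. Together with the weight
  \<open>2 * k + 1\<close> this gives \<open>2 * n + 1\<close>, independent of
  \<open>k\<close>.\<close>

lemma G_recurrence:
  "(x + 1)\<^sup>2 * G n (x + 1) = (2 * x + 1) * (2 * of_nat n + 1) * G n x + x\<^sup>2 * G n (x - 1)"
proof -
  define c :: "nat \<Rightarrow> 'a" where "c k = of_nat (n choose k)" for k
  have absorb: "of_nat (Suc k) * c (Suc k) = (of_nat n - of_nat k) * c k" if "k < n" for k
  proof -
    have "Suc k * (n choose Suc k) = (n - k) * (n choose k)"
      by (simp only: binomial_absorb_comp binomial_absorption)
    then show ?thesis using that
      by (metis (mono_tags) c_def of_nat_diff of_nat_mult order.strict_implies_order)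
  qed
  have shift: "(\<Sum>k\<le>n. c k * (of_nat k * gterm (k - 1) x)) = (\<Sum>k\<le>n. (of_nat n - of_nat k) * c k * gterm k x)"
  proof (cases n)
    case (Suc m)
    have "(\<Sum>k\<le>n. c k * (of_nat k * gterm (k - 1) x))
        = (\<Sum>k\<le>m. of_nat (Suc k) * c (Suc k) * gterm k x)"
      unfolding Suc by (subst sum.atMost_Suc_shift) (simp add: mult_ac)
    also have "\<dots> = (\<Sum>k\<le>m. (of_nat n - of_nat k) * c k * gterm k x)"
      by (rule sum.cong[OF refl]) (subst absorb, use Suc in auto)
    also have "\<dots> = (\<Sum>k\<le>n. (of_nat n - of_nat k) * c k * gterm k x)"
      unfolding Suc by simp
    finally show ?thesis .
  qed simp
  have "(x + 1)\<^sup>2 * G n (x + 1) - x\<^sup>2 * G n (x - 1)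
      = (\<Sum>k\<le>n. c k * ((x + 1)\<^sup>2 * gterm k (x + 1) - x\<^sup>2 * gterm k (x - 1)))"
    unfolding G_altdef c_def sum_distrib_left sum_subtractf [symmetric]
    by (rule sum.cong) (simp_all add: algebra_simps)
  also have "\<dots> = (2 * x + 1) * ((\<Sum>k\<le>n. (2 * of_nat k + 1) * c k * gterm k x)
      + 2 * (\<Sum>k\<le>n. c k * (of_nat k * gterm (k - 1) x)))"
    unfolding gterm_recurrence sum_distrib_left sum.distrib [symmetric]
    by (rule sum.cong) (simp_all add: algebra_simps)
  also have "\<dots> = (2 * x + 1) * (\<Sum>k\<le>n. (2 * of_nat n + 1) * (c k * gterm k x))"
    unfolding shift sum_distrib_left sum.distrib [symmetric]
    by (rule sum.cong) (simp_all add: algebra_simps)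
  also have "\<dots> = (2 * x + 1) * (2 * of_nat n + 1) * G n x"
    by (simp add: G_altdef c_def sum_distrib_left mult.assoc)
  finally show ?thesis by (simp add: algebra_simps)
qed

text \<open>By Pascal's rule the left side grows by \<open>1 / (n + 1)\<close> from \<open>n\<close>
  to \<open>n + 1\<close>. For \<open>n = p - 1\<close> it is the linear coefficient in the
  expansion of \<open>G\<close> at multiples of \<open>p\<close>. That coefficient is needed modulo
  \<open>p^2\<close>, beyond the reach of the congruence for \<open>p - 1\<close> choose
  \<open>k\<close> modulo \<open>p\<close>; hence the exact identity.\<close>

lemma sum_binomial_alternating_harmonic:
  "(\<Sum>k=1..n. of_nat (n choose k) * (-1) ^ (k - 1) / of_nat k) = (\<Sum>k=1..n. 1 / of_nat k :: 'a::field_char_0)"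
proof (induction n)
  case (Suc n)
  define s :: "nat \<Rightarrow> 'a" where "s k = (-1) ^ (k - 1) / of_nat k" for k
  have "(\<Sum>k=1..Suc n. of_nat (n choose (k - 1)) * s k)
      = (\<Sum>k=1..Suc n. - (of_nat (Suc n choose k) * (-1) ^ k) / of_nat (Suc n))"
  proof (rule sum.cong[OF refl])
    fix k assume "k \<in> {1..Suc n}"
    then obtain j where k: "k = Suc j" by (cases k) auto
    have "of_nat (Suc j) * of_nat (Suc n choose Suc j) = (of_nat (Suc n) * of_nat (n choose j) :: 'a)"
      by (metis Suc_times_binomial of_nat_mult)
    then show "of_nat (n choose (k - 1)) * s k = - (of_nat (Suc n choose k) * (-1) ^ k) / of_nat (Suc n)"
      unfolding k s_def by (simp add: field_simps del: of_nat_Suc binomial_Suc_Suc)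
  qed
  also have "\<dots> = - (\<Sum>k=1..Suc n. of_nat (Suc n choose k) * (-1) ^ k) / of_nat (Suc n)"
    by (simp only: sum_divide_distrib sum_negf [symmetric])
  also have "(\<Sum>k=1..Suc n. of_nat (Suc n choose k) * (-1 :: 'a) ^ k) = -1"
  proof -
    have "(\<Sum>k\<le>Suc n. of_nat (Suc n choose k) * (-1 :: 'a) ^ k) = 0"
      using choose_alternating_sum[of "Suc n", where 'a = 'a] by (simp only: mult.commute)
    \<comment> \<open>The alternating row sum vanishes because the row index \<open>Suc n\<close> is
      positive; the term \<open>k = 0\<close> is split off.\<close>
    then have "1 + (\<Sum>k=1..Suc n. of_nat (Suc n choose k) * (-1 :: 'a) ^ k) = 0"
      unfolding atMost_atLeast0 by (subst (asm) sum.atLeast_Suc_atMost) (simp_all del: sum.cl_ivl_Suc binomial_Suc_Suc)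
    then show ?thesis by (simp only: eq_neg_iff_add_eq_0 add.commute)
  qed
  finally have *: "(\<Sum>k=1..Suc n. of_nat (n choose (k - 1)) * s k) = 1 / of_nat (Suc n)" by simp
  have "(\<Sum>k=1..Suc n. of_nat (Suc n choose k) * s k)
      = (\<Sum>k=1..Suc n. of_nat (n choose k) * s k + of_nat (n choose (k - 1)) * s k)"
  proof (rule sum.cong[OF refl])
    fix k assume "k \<in> {1..Suc n}"
    then obtain j where k: "k = Suc j" by (cases k) auto
    show "of_nat (Suc n choose k) * s k = of_nat (n choose k) * s k + of_nat (n choose (k - 1)) * s k"
      unfolding k by (simp add: algebra_simps)
  qed
  also have "\<dots> = (\<Sum>k=1..n. of_nat (n choose k) * s k) + 1 / of_nat (Suc n)"
    unfolding sum.distrib * by simp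
  finally show ?case using Suc by (simp add: s_def)
qed simp

section \<open>Congruences of Wolstenholme type and \<open>G\<close> at multiples of
  \<open>p\<close>\<close>

context
  fixes p :: nat
  assumes p: "prime p"
begin

text \<open>Neighbours in row \<open>p - 1\<close> of Pascal's triangle add up to an entry of row
  \<open>p\<close> that is divisible by \<open>p\<close>, so the residues alternate in sign.\<close>

lemma binomial_prime_minus_1:
  assumes "k < p"
  shows "pdiv p 1 (of_nat ((p - 1) choose k) - (-1) ^ k)"
  using assms
proof (induction k)
  case (Suc k)
  have "p choose Suc k = ((p - 1) choose k) + ((p - 1) choose Suc k)"
    using Suc.prems by (cases p) auto
  moreover have "p dvd (p choose Suc k)"
    using Suc.prems p by (intro dvd_choose_prime) auto
  ultimately have "pdiv p 1 (of_nat (((p - 1) choose k) + ((p - 1) choose Suc k)))"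
    using pdiv_of_nat_iff[OF p] by metis
  moreover have "pdiv p 1 (of_nat ((p - 1) choose k) - (-1) ^ k)" using Suc by simp
  ultimately have "pdiv p 1 (of_nat (((p - 1) choose k) + ((p - 1) choose Suc k))
       - (of_nat ((p - 1) choose k) - (-1) ^ k))" by (rule pdiv_diff)
  then show ?case by simp
qed simp

lemma Zp_inverse_less: "0 < k \<Longrightarrow> k < p \<Longrightarrow> 1 / of_nat k \<in> Zp p"
  by (intro Zp_inverse_of_nat[OF p]) (auto dest: dvd_imp_le)

lemma pdiv_inverse_diff:
  assumes "pdiv p m (a - b)" "1 / a \<in> Zp p" "1 / b \<in> Zp p" "a \<noteq> 0" "b \<noteq> 0"
  shows "pdiv p m (1 / a - 1 / b)"
proof -
  have "1 / a - 1 / b = - ((a - b) * (1 / a * (1 / b)))" using assms by (simp add: field_simps)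
  then show ?thesis using assms by (simp add: pdiv_uminus_iff pdiv_scale_right del: times_divide_eq_right times_divide_eq_left)
qed

context
  assumes p3: "p > 3"
begin

text \<open>Doubling permutes the nonzero residues, so the sum S satisfies S = S/4 modulo
  \<open>p\<close>. Hence 3S/4 vanishes, and 3 is a unit because \<open>p > 3\<close>.\<close>

lemma sum_inverse_squares:
  "pdiv p 1 (\<Sum>k=1..<p. 1 / (of_nat k)\<^sup>2)"
proof -
  define f :: "nat \<Rightarrow> rat" where "f k = 1 / (of_nat k)\<^sup>2" for k
  have Zf: "1 / (of_nat k)\<^sup>2 \<in> Zp p" if "0 < k" "k < p" for k
    using Zp_power[OF Zp_inverse_less[OF that], of 2] by (simp add: power_one_over)
  have op: "coprime 2 p" using p p3 prime_odd_nat by simp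
  define \<pi> where "\<pi> k = 2 * k mod p" for k
  have pos: "\<pi> k \<in> {1..<p}" if "k \<in> {1..<p}" for k
  proof -
    have "\<not> p dvd 2 * k" using that op
      by (metis coprime_commute coprime_dvd_mult_right_iff atLeastLessThan_iff dvd_imp_le not_less less_eq_Suc_le One_nat_def)
    then show ?thesis using that by (auto simp: \<pi>_def dvd_eq_mod_eq_0 Suc_le_eq)
  qed
  have inj: "inj_on \<pi> {1..<p}"
  proof (rule inj_onI)
    fix a b assume ab: "a \<in> {1..<p}" "b \<in> {1..<p}" "\<pi> a = \<pi> b"
    then have "[2 * a = 2 * b] (mod p)" by (simp add: \<pi>_def cong_def)
    then have "[a = b] (mod p)" using op by (simp add: cong_mult_lcancel_nat)
    then show "a = b" using ab by (simp add: cong_less_modulus_unique_nat)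
  qed
  have "\<pi> ` {1..<p} = {1..<p}" using inj pos by (intro endo_inj_surj) auto
  then have eq: "sum f {1..<p} = (\<Sum>k=1..<p. f (\<pi> k))" using sum.reindex[OF inj, of f] by simp
  have "pdiv p 1 (f (\<pi> k) - f k / 4)" if k: "k \<in> {1..<p}" for k
  proof -
    have "2 * k = p * (2 * k div p) + \<pi> k" by (simp add: \<pi>_def)
    then have "of_nat (2 * k) = (of_nat p * of_nat (2 * k div p) + of_nat (\<pi> k) :: rat)"
      by (metis of_nat_add of_nat_mult)
    then have "of_nat (\<pi> k) - 2 * of_nat k = (- (of_nat p * of_nat (2 * k div p)) :: rat)" by simp
    then have "pdiv p 1 (of_nat (\<pi> k) - 2 * of_nat k)" by (simp only: pdiv_uminus_iff) (rule pdiv_p, simp)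
    then have "pdiv p 1 ((of_nat (\<pi> k))\<^sup>2 - (2 * of_nat k)\<^sup>2)" by (rule pdiv_power_cong) auto
    moreover have "1 / (2 * of_nat k)\<^sup>2 \<in> Zp p"
      using Zp_mult[OF Zf[of 2] Zf[of k]] k p3 by (simp add: power_mult_distrib)
    ultimately have "pdiv p 1 (1 / (of_nat (\<pi> k))\<^sup>2 - 1 / (2 * of_nat k)\<^sup>2)"
      using Zf[of "\<pi> k"] pos[OF k] k by (intro pdiv_inverse_diff) auto
    then show ?thesis by (simp add: f_def power_mult_distrib mult.commute)
  qed
  then have "pdiv p 1 (\<Sum>k=1..<p. f (\<pi> k) - f k / 4)" by (rule pdiv_sum)
  then have "pdiv p 1 (sum f {1..<p} - sum f {1..<p} / 4)"
    by (simp only: sum_subtractf sum_divide_distrib [symmetric] eq [symmetric])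
  then have "pdiv p 1 (4 * (1 / of_nat 3) * (sum f {1..<p} - sum f {1..<p} / 4))"
    using Zp_inverse_less[of 3] p3 by (intro pdiv_scale Zp_mult) auto
  then show ?thesis by (simp add: f_def)
qed

text \<open>Pairing \<open>k\<close> with \<open>p - k\<close> extracts one factor \<open>p\<close>;
  the remaining terms \<open>1 / (k * (p - k))\<close> are congruent to \<open>- 1 / k^2\<close>,
  and \<open>sum_inverse_squares\<close> supplies the second factor.\<close>

lemma wolstenholme: "pdiv p 2 (\<Sum>k=1..<p. 1 / of_nat k)"
proof -
  define h :: rat where "h = (\<Sum>k=1..<p. 1 / of_nat k)"
  have "h = (\<Sum>k=1..<p. 1 / of_nat (p - k))"
    unfolding h_def by (rule sum.reindex_bij_witness[of _ "\<lambda>k. p - k" "\<lambda>k. p - k"]) auto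
  then have "2 * h = (\<Sum>k=1..<p. 1 / of_nat k + 1 / of_nat (p - k))"
    by (simp add: h_def sum.distrib)
  also have "\<dots> = of_nat p * (\<Sum>k=1..<p. 1 / (of_nat k * of_nat (p - k)))"
    unfolding sum_distrib_left by (rule sum.cong) (auto simp: field_simps of_nat_diff)
  finally have e: "2 * h = of_nat p * (\<Sum>k=1..<p. 1 / (of_nat k * of_nat (p - k)))" .
  have "pdiv p 1 (1 / (of_nat k * of_nat (p - k)) + 1 / (of_nat k)\<^sup>2)" if "k \<in> {1..<p}" for k
  proof -
    have k: "1 / of_nat k \<in> Zp p" "1 / of_nat (p - k) \<in> Zp p"
      using that by (auto intro!: Zp_inverse_less simp del: of_nat_diff)
    have "1 / (of_nat k * of_nat (p - k)) + 1 / (of_nat k)\<^sup>2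
        = of_nat p * ((1 / of_nat k)\<^sup>2 * (1 / of_nat (p - k)) :: rat)"
      using that by (simp add: field_simps power2_eq_square of_nat_diff)
    then show ?thesis using k by (simp only: pdiv_p Zp_mult Zp_power)
  qed
  then have "pdiv p 1 (\<Sum>k=1..<p. 1 / (of_nat k * of_nat (p - k)) + 1 / (of_nat k)\<^sup>2)"
    by (rule pdiv_sum)
  then have "pdiv p 1 ((\<Sum>k=1..<p. 1 / (of_nat k * of_nat (p - k))) + (\<Sum>k=1..<p. 1 / (of_nat k)\<^sup>2))"
    by (simp only: sum.distrib)
  from pdiv_diff[OF this sum_inverse_squares]
  have "pdiv p 1 (\<Sum>k=1..<p. 1 / (of_nat k * of_nat (p - k)))" by simp
  from pdiv_mult[OF pdiv_p[OF Zp_1] this] have "pdiv p 2 (2 * h)" unfolding e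
    by (simp add: numeral_2_eq_2)
  then have "pdiv p 2 ((1 / of_nat 2) * (2 * h))"
    using Zp_inverse_less[of 2] p3 by (intro pdiv_scale[of p 2 "2 * h"]) auto
  then show ?thesis by (simp add: h_def)
qed

text \<open>With K for \<open>Suc k\<close>, the factors regroup to \<open>y * (y + K)\<close> times
  the product of \<open>y^2 - i^2\<close> over \<open>0 < i < K\<close>, divided by the square of
  \<open>fact K\<close>. In that product \<open>y^2\<close> only affects terms of order
  \<open>y^3\<close>, which leaves \<open>y * (y + K) / K^2\<close> up to sign.\<close>

lemma gterm_p_multiple:
  assumes y: "pdiv p 1 y" and "Suc k < p"
  shows "pdiv p 3 (gterm (Suc k) y - (-1) ^ k * (y / of_nat (Suc k) + y\<^sup>2 / (of_nat (Suc k))\<^sup>2))"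
  using assms(2)
proof (induction k)
  case 0
  show ?case using gterm_Suc[of 0 y] by (simp add: power2_eq_square algebra_simps)
next
  case (Suc k)
  define a b where "a = (of_nat (Suc k) :: rat)" and "b = (of_nat (Suc (Suc k)) :: rat)"
  have b: "b = a + 1" and ab0: "a \<noteq> 0" "b \<noteq> 0" by (simp_all add: a_def b_def)
  have inv: "1 / a \<in> Zp p" "1 / b \<in> Zp p"
    unfolding a_def b_def using Suc.prems Zp_inverse_less[of "Suc k"] Zp_inverse_less[of "Suc (Suc k)"]
    by (simp_all del: of_nat_Suc)
  have Zab: "a \<in> Zp p" "b \<in> Zp p" unfolding a_def b_def by (simp_all only: Zp_of_nat)
  define h where "h = gterm (Suc k) y"
  define s where "s = ((-1) ^ k :: rat)"
  have Zs: "s \<in> Zp p" by (simp add: s_def)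
  have Zy: "y \<in> Zp p" using y by (rule pdiv_Zp)
  have IH: "pdiv p 3 (h - s * (y / a + y\<^sup>2 / a\<^sup>2))" using Suc by (simp add: h_def s_def a_def)
  have "b\<^sup>2 * gterm (Suc (Suc k)) y = h * ((y - a) * (y + b))"
    using gterm_Suc[of "Suc k" y] by (simp add: a_def b_def h_def algebra_simps)
  then have "gterm (Suc (Suc k)) y = h * ((y - a) * (y + b)) * (1 / b)\<^sup>2"
    using ab0 by (simp add: field_simps)
  also have "\<dots> - (-1) ^ Suc k * (y / b + y\<^sup>2 / b\<^sup>2)
      = (h - s * (y / a + y\<^sup>2 / a\<^sup>2)) * ((y - a) * (y + b) * (1 / b)\<^sup>2) + y ^ 3 * (s * (y + b) * (1 / a)\<^sup>2 * (1 / b)\<^sup>2)"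
    using ab0 unfolding s_def [symmetric] power_Suc
    by (simp add: field_simps power2_eq_square power3_eq_cube)
  also have "pdiv p 3 \<dots>"
    using IH pdiv_power[OF y, of 3] inv Zab Zs Zy by (intro pdiv_add pdiv_scale_right) simp_all
  finally show ?case by (simp add: b_def)
qed

text \<open>The linear coefficient of the expansion in \<open>y\<close> is a harmonic number,
  divisible by \<open>p^2\<close>; the quadratic one is congruent to minus the sum of inverse
  squares, divisible by \<open>p\<close>. With \<open>p\<close> dividing \<open>y\<close>, both
  terms vanish modulo \<open>p^3\<close>.\<close>

lemma G_p_multiple:
  assumes y: "pdiv p 1 y"
  shows "pdiv p 3 (G (p - 1) y - 1)"
proof -
  define c where "c k = (of_nat ((p - 1) choose k) :: rat)" for k
  have Zc: "c k \<in> Zp p" for k by (simp add: c_def)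
  have Ip: "{1..p-1} = {1..<p}" using p3 by auto
  have "G (p - 1) y = c 0 * gterm 0 y + (\<Sum>k=1..p-1. c k * gterm k y)"
    unfolding G_altdef c_def atMost_atLeast0 by (subst sum.atLeast_Suc_atMost) auto
  then have "G (p - 1) y - 1 = (\<Sum>k=1..<p. c k * gterm k y)" by (simp only: Ip) (simp add: c_def)
  \<comment> \<open>In the quadratic part \<open>c k\<close> is split as \<open>(-1) ^ k\<close>
    plus a multiple of \<open>p\<close>. The minus sign of the last sum is
    \<open>(-1) ^ k * (-1) ^ (k - 1)\<close>.\<close>
  also have "\<dots> = (\<Sum>k=1..<p. c k * (gterm k y - (-1) ^ (k - 1) * (y / of_nat k + y\<^sup>2 / (of_nat k)\<^sup>2)))
      + y * (\<Sum>k=1..<p. c k * (-1) ^ (k - 1) / of_nat k)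
      + y\<^sup>2 * (\<Sum>k=1..<p. (c k - (-1) ^ k) * ((-1) ^ (k - 1) * (1 / of_nat k)\<^sup>2))
      - y\<^sup>2 * (\<Sum>k=1..<p. 1 / (of_nat k)\<^sup>2)"
  proof -
    have "c k * gterm k y = c k * (gterm k y - (-1) ^ (k - 1) * (y / of_nat k + y\<^sup>2 / (of_nat k)\<^sup>2))
      + y * (c k * (-1) ^ (k - 1) / of_nat k)
      + y\<^sup>2 * ((c k - (-1) ^ k) * ((-1) ^ (k - 1) * (1 / of_nat k)\<^sup>2))
      - y\<^sup>2 * (1 / (of_nat k)\<^sup>2)" if k: "k \<in> {1..<p}" for k
    proof -
      obtain j where j: "k = Suc j" using k by (cases k) auto
      define s where "s = (-1 :: rat) ^ j"
      have s: "s * (s * z) = z" for z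
        unfolding s_def by (simp add: mult.assoc [symmetric] power_add [symmetric])
      show ?thesis unfolding j divide_inverse power_inverse [symmetric] power_Suc diff_Suc_1 s_def [symmetric]
        by (simp add: algebra_simps s)
    qed
    then show ?thesis
      unfolding sum_distrib_left sum.distrib [symmetric] sum_subtractf [symmetric] by (rule sum.cong[OF refl])
  qed
  also have "pdiv p 3 \<dots>"
  proof (intro pdiv_add pdiv_diff)
    show "pdiv p 3 (\<Sum>k=1..<p. c k * (gterm k y - (-1) ^ (k - 1) * (y / of_nat k + y\<^sup>2 / (of_nat k)\<^sup>2)))"
    proof (intro pdiv_sum pdiv_scale Zc)
      fix k assume k: "k \<in> {1..<p}"
      then obtain j where j: "k = Suc j" by (cases k) auto
      show "pdiv p 3 (gterm k y - (-1) ^ (k - 1) * (y / of_nat k + y\<^sup>2 / (of_nat k)\<^sup>2))"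
        using gterm_p_multiple[OF y, of j] k by (simp add: j)
    qed
    have "pdiv p (1 + 2) (y * (\<Sum>k=1..<p. 1 / of_nat k))" by (intro pdiv_mult y wolstenholme)
    then show "pdiv p 3 (y * (\<Sum>k=1..<p. c k * (-1) ^ (k - 1) / of_nat k))"
      using sum_binomial_alternating_harmonic[of "p - 1", where 'a = rat] by (simp only: c_def Ip) (simp add: numeral_3_eq_3)
    have "pdiv p 1 (\<Sum>k=1..<p. (c k - (-1) ^ k) * ((-1) ^ (k - 1) * (1 / of_nat k)\<^sup>2))"
      unfolding c_def using Zp_inverse_less
      by (intro pdiv_sum pdiv_scale_right binomial_prime_minus_1 Zp_mult Zp_power) auto
    from pdiv_mult[OF pdiv_power[OF y, of 2] this]
    show "pdiv p 3 (y\<^sup>2 * (\<Sum>k=1..<p. (c k - (-1) ^ k) * ((-1) ^ (k - 1) * (1 / of_nat k)\<^sup>2)))" by simp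
    from pdiv_mult[OF pdiv_power[OF y, of 2] sum_inverse_squares]
    show "pdiv p 3 (y\<^sup>2 * (\<Sum>k=1..<p. 1 / (of_nat k)\<^sup>2))" by simp
  qed
  finally show ?thesis .
qed

end

end

subsection \<open>The value of G along an arithmetic progression\<close>

definition hsum :: "rat \<Rightarrow> nat \<Rightarrow> rat" where
  "hsum y r = (\<Sum>j=1..r. 1 / (y + of_nat j))"

definition qsum :: "rat \<Rightarrow> nat \<Rightarrow> rat" where
  "qsum y r = (\<Sum>j=1..r. (-1) ^ j / (y + of_nat j)\<^sup>2)"

context
  fixes p :: nat and y :: rat
  assumes p: "prime p" and p3: "p > 3" and y: "pdiv p 1 y"
begin

lemma y_Zp: "y \<in> Zp p"
  using y by (rule pdiv_Zp)

lemma shift_unit: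
  assumes "0 < j" "j < p"
  shows "\<not> pdiv p 1 (y + of_nat j)" "1 / (y + of_nat j) \<in> Zp p" "(y + of_nat j) \<noteq> 0"
proof -
  show *: "\<not> pdiv p 1 (y + of_nat j)"
  proof
    assume "pdiv p 1 (y + of_nat j)"
    from pdiv_diff[OF this y] have "pdiv p 1 (of_nat j)" by simp
    then have "p dvd j" by (simp only: pdiv_of_nat_iff[OF p])
    then show False using assms by (auto dest: dvd_imp_le)
  qed
  then show "1 / (y + of_nat j) \<in> Zp p" using y_Zp by (intro Zp_inverse[OF p]) auto
  show "(y + of_nat j) \<noteq> 0" using * by (metis pdiv_0)
qed

lemma hsum_Zp: "r < p \<Longrightarrow> hsum y r \<in> Zp p"
  unfolding hsum_def by (intro Zp_sum shift_unit) auto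

text \<open>The two congruences support each other. \<open>G\<close> modulo \<open>p^2\<close> at
  \<open>x\<close> advances the first one, because the difference of \<open>D\<close> carries a
  factor \<open>2 * p\<close>; the new value of \<open>D\<close> then gives \<open>G\<close> at
  \<open>x + 1\<close> modulo \<open>p^3\<close>, since \<open>(x + 1)^2\<close> is a unit.\<close>

lemma G_mod_p3:
  assumes "r < p"
  shows "pdiv p 3 ((y + of_nat r)\<^sup>2 * (G (p - 1) (y + of_nat r) + G (p - 1) ((y + of_nat r) - 1))
           - (2 * y\<^sup>2 + 2 * of_nat p * y - 2 * of_nat p * (-1) ^ r * (y + of_nat r)
              + 4 * (of_nat p)\<^sup>2 * (-1) ^ r * (y + of_nat r) * hsum y r - 2 * (of_nat p)\<^sup>2 * ((-1) ^ r - 1)))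
       \<and> pdiv p 3 ((-1) ^ r * G (p - 1) (y + of_nat r)
           - (1 - 2 * of_nat p * hsum y r + 2 * (of_nat p)\<^sup>2 * (hsum y r)\<^sup>2
              + 2 * (y\<^sup>2 + of_nat p * y + (of_nat p)\<^sup>2) * qsum y r))"
  using assms
proof (induction r)
  case 0
  have my: "pdiv p 1 (- y)" using y by (simp add: pdiv_uminus_iff)
  have a: "pdiv p 3 (G (p - 1) y - 1)" by (rule G_p_multiple[OF p p3 y])
  \<comment> \<open>The reflection sends \<open>y - 1\<close> to \<open>- y\<close>, again a
    multiple of \<open>p\<close>.\<close>
  have b: "pdiv p 3 (G (p - 1) (y - 1) - 1)"
    using G_p_multiple[OF p p3 my] G_reflect[of "p - 1" "y - 1"] by simp
  from pdiv_scale[OF pdiv_add[OF a b], of "y\<^sup>2"]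
  have "pdiv p 3 (y\<^sup>2 * (G (p - 1) y + G (p - 1) (y - 1)) - 2 * y\<^sup>2)"
    using y_Zp by (simp add: algebra_simps)
  then show ?case using a by (simp add: hsum_def qsum_def)
next
  case (Suc r)
  define P where "P = (of_nat p :: rat)"
  define s where "s = (-1 :: rat) ^ r"
  define x where "x = (y + of_nat r)"
  define g where "g = G (p - 1) x"
  define w where "w = 1 / (x + 1)"
  have s: "s * s = 1" unfolding s_def by (simp add: power_add [symmetric])
  have x1: "x + 1 \<noteq> 0" "(y + of_nat (Suc r)) = x + 1" using shift_unit[of "Suc r"] Suc.prems by (simp_all add: x_def add_ac)
  have Zw: "w \<in> Zp p" using shift_unit(2)[of "Suc r"] Suc.prems unfolding x1(2) w_def by simp
  have w1: "w * (x + 1) = 1" using x1 by (simp add: w_def)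
  have h: "hsum y (Suc r) = hsum y r + w" and q: "qsum y (Suc r) = qsum y r - s * w\<^sup>2"
    by (simp_all add: hsum_def qsum_def x1(2) w_def s_def power_one_over del: of_nat_Suc)
  define H Q where "H = hsum y r" and "Q = qsum y r"
  define D where "D = x\<^sup>2 * (g + G (p - 1) (x - 1))"
  define D' where "D' = (x + 1)\<^sup>2 * (G (p - 1) (x + 1) + g)"
  \<comment> \<open>\<open>F\<close> is the sum of the differences of \<open>D\<close> with
    \<open>G\<close> replaced by \<open>s * (1 - 2 * P * H)\<close>, evaluated by parts:
    \<open>(-1)^i * (2 * x_i + 1)\<close> is the difference
    \<open>(-1)^i * x_i - (-1)^(i+1) * x_(i+1)\<close>. The increments of \<open>H\<close> cancel
    against \<open>x_(i+1)\<close>, which leaves the alternating sum behind the last term.\<close>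
  define F where "F = 2 * y\<^sup>2 + 2 * P * y - 2 * P * s * x + 4 * P\<^sup>2 * s * x * H - 2 * P\<^sup>2 * (s - 1)"
  define F' where "F' = 2 * y\<^sup>2 + 2 * P * y + 2 * P * s * (x + 1) - 4 * P\<^sup>2 * s * (x + 1) * (H + w) + 2 * P\<^sup>2 * (s + 1)"
  define A where "A = 1 - 2 * P * H + 2 * P\<^sup>2 * H\<^sup>2 + 2 * (y\<^sup>2 + P * y + P\<^sup>2) * Q"
  have IH1: "pdiv p 3 (D - F)" and IH2: "pdiv p 3 (s * g - A)"
    using Suc by (simp_all add: D_def F_def A_def s_def x_def g_def P_def H_def Q_def)
  have Z: "x \<in> Zp p" "s \<in> Zp p" "P \<in> Zp p" "H \<in> Zp p"
    using y_Zp hsum_Zp[of r] Suc.prems by (simp_all add: x_def s_def P_def H_def)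
  have ZQ: "Q \<in> Zp p"
  proof -
    have "(-1) ^ j / (y + of_nat j)\<^sup>2 \<in> Zp p" if "j \<in> {1..r}" for j
    proof -
      have "(-1) ^ j * (1 / (y + of_nat j))\<^sup>2 \<in> Zp p" using shift_unit(2)[of j] that Suc.prems by simp
      then show ?thesis by (simp add: power_one_over)
    qed
    then show ?thesis unfolding Q_def qsum_def by (rule Zp_sum)
  qed
  have P1: "pdiv p 1 P" using pdiv_p[of 1 p] by (simp add: P_def)
  have P2: "pdiv p 2 (P\<^sup>2)" using pdiv_power[OF P1] .
  have y2: "pdiv p 2 (y\<^sup>2)" using pdiv_power[OF y] .
  have Py: "pdiv p 2 (P * y)" using pdiv_mult[OF P1 y] by (simp add: numeral_2_eq_2)
  \<comment> \<open>Modulo \<open>p^2\<close> only the linear part of \<open>A\<close> remains, and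
    that is all the recurrence for \<open>D\<close> requires.\<close>
  have "pdiv p 2 (2 * P\<^sup>2 * H\<^sup>2 + 2 * (y\<^sup>2 + P * y + P\<^sup>2) * Q)"
    using P2 y2 Py Z ZQ by (auto intro!: pdiv_add pdiv_scale_right[of p 2 _ Q] pdiv_scale_right[of p 2 _ "H\<^sup>2"] pdiv_scale[of p 2 _ 2])
  moreover have "pdiv p 2 (s * g - A)" using IH2 by (rule pdiv_mono) simp
  ultimately have "pdiv p 2 (s * g - A + (2 * P\<^sup>2 * H\<^sup>2 + 2 * (y\<^sup>2 + P * y + P\<^sup>2) * Q))"
    using pdiv_add by blast
  then have g2: "pdiv p 2 (s * g - (1 - 2 * P * H))" by (simp add: A_def algebra_simps)
  have rec: "D' = D + 2 * P * (2 * x + 1) * g"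
  proof -
    have "2 * of_nat (p - 1) + 1 = 2 * P - (1 :: rat)"
      using p3 by (simp add: P_def of_nat_diff)
    then have "(x + 1)\<^sup>2 * G (p - 1) (x + 1) = (2 * x + 1) * (2 * P - 1) * g + x\<^sup>2 * G (p - 1) (x - 1)"
      using G_recurrence[of x "p - 1"] by (simp only: g_def)
    then have "D' = (2 * x + 1) * (2 * P - 1) * g + x\<^sup>2 * G (p - 1) (x - 1) + (x + 1)\<^sup>2 * g"
      by (simp add: D'_def distrib_left)
    then show ?thesis by (simp add: D_def power2_eq_square algebra_simps)
  qed
  have "D' - F' = (D - F) + (2 * P) * ((2 * x + 1) * s) * (s * g - (1 - 2 * P * H))"
  proof -
    have F'': "F' = 2 * y\<^sup>2 + 2 * P * y + 2 * P * s * (x + 1) - 4 * P\<^sup>2 * s * ((x + 1) * H + 1) + 2 * P\<^sup>2 * (s + 1)"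
    proof -
      have e: "(x + 1) * (H + w) = (x + 1) * H + 1" using w1 by (simp add: algebra_simps)
      show ?thesis by (simp only: F'_def mult.assoc e)
    qed
    have "(2 * P) * ((2 * x + 1) * s) * (s * g - (1 - 2 * P * H)) = 2 * P * (2 * x + 1) * ((s * s) * g - s * (1 - 2 * P * H))"
      by (simp only: algebra_simps)
    then show ?thesis unfolding rec F'' F_def s by (simp add: power2_eq_square algebra_simps)
  qed
  moreover have "pdiv p 3 ((2 * P) * ((2 * x + 1) * s) * (s * g - (1 - 2 * P * H)))"
    using pdiv_mult[OF pdiv_scale_right[OF pdiv_scale[OF P1, of 2], of "(2 * x + 1) * s"] g2] Z
    by (simp add: numeral_3_eq_3)
  ultimately have 1: "pdiv p 3 (D' - F')" using IH1 by (metis pdiv_add)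
  define A' where "A' = 1 - 2 * P * (H + w) + 2 * P\<^sup>2 * (H + w)\<^sup>2 + 2 * (y\<^sup>2 + P * y + P\<^sup>2) * (Q - s * w\<^sup>2)"
  \<comment> \<open>Here \<open>w^2 * D'\<close> is \<open>G (p - 1) (x + 1) + g\<close>, so the
    congruence for \<open>D'\<close>, divided by \<open>(x + 1)^2\<close>, is subtracted from the
    one for \<open>g\<close>. The square of \<open>H + w\<close> is completed by the terms
    \<open>4 * P^2 * w * (H + w) - 2 * P^2 * w^2\<close>.\<close>
  have "- s * G (p - 1) (x + 1) - A' = (s * g - A) - (s * w\<^sup>2) * (D' - F')"
  proof -
    have "w\<^sup>2 * D' = (w * (x + 1))\<^sup>2 * (G (p - 1) (x + 1) + g)"
      by (simp only: D'_def power_mult_distrib mult.assoc)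
    then have wD: "w\<^sup>2 * D' = G (p - 1) (x + 1) + g" by (simp add: w1)
    have wF0: "w\<^sup>2 * F' = 2 * w\<^sup>2 * (y\<^sup>2 + P * y) + 2 * P * s * w * (w * (x + 1)) - 4 * P\<^sup>2 * s * w * (w * (x + 1)) * (H + w) + 2 * P\<^sup>2 * w\<^sup>2 * (s + 1)"
      unfolding F'_def by (simp add: power2_eq_square algebra_simps)
    have "s * (w\<^sup>2 * F') = 2 * s * w\<^sup>2 * (y\<^sup>2 + P * y + P\<^sup>2) + (s * s) * (2 * P * w - 4 * P\<^sup>2 * w * (H + w) + 2 * P\<^sup>2 * w\<^sup>2)"
      unfolding wF0 w1 by (simp add: algebra_simps)
    then have wF: "s * (w\<^sup>2 * F') = 2 * s * w\<^sup>2 * (y\<^sup>2 + P * y + P\<^sup>2) + (2 * P * w - 4 * P\<^sup>2 * w * (H + w) + 2 * P\<^sup>2 * w\<^sup>2)"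
      unfolding s by simp
    have "(s * w\<^sup>2) * (D' - F') = s * (w\<^sup>2 * D') - s * (w\<^sup>2 * F')" by (simp add: algebra_simps)
    then show ?thesis unfolding wD wF A_def A'_def by (simp add: power2_eq_square algebra_simps)
  qed
  moreover have "pdiv p 3 ((s * w\<^sup>2) * (D' - F'))" using 1 Z Zw by (intro pdiv_scale) auto
  ultimately have 2: "pdiv p 3 (- s * G (p - 1) (x + 1) - A')" using IH2 by (metis pdiv_diff)
  have sS: "(-1 :: rat) ^ Suc r = - s" by (simp add: s_def)
  show ?case unfolding x1(2) h q sS P_def [symmetric] H_def [symmetric] Q_def [symmetric]
    using 1 2 by (simp add: D'_def F'_def A'_def g_def algebra_simps)
qed

end

subsection \<open>Exponential generating functions\<close>

definition egf :: "(nat \<Rightarrow> rat) \<Rightarrow> rat fps" where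
  "egf f = Abs_fps (\<lambda>n. f n / fact n)"

lemma egf_nth [simp]: "egf f $ n = f n / fact n"
  by (simp add: egf_def)

lemma egf_eq_iff: "egf f = egf g \<longleftrightarrow> (\<forall>n. f n = g n)"
  by (simp add: fps_eq_iff)

lemma egf_power: "egf (\<lambda>n. c ^ n) = fps_exp c"
  by (simp add: fps_eq_iff)

lemma egf_add: "egf f + egf g = egf (\<lambda>n. f n + g n)"
  and egf_diff: "egf f - egf g = egf (\<lambda>n. f n - g n)"
  by (simp_all add: fps_eq_iff field_simps)

lemma egf_sum: "(\<Sum>i\<in>A. egf (f i)) = egf (\<lambda>n. \<Sum>i\<in>A. f i n)"
  by (simp add: fps_eq_iff fps_sum_nth sum_divide_distrib)

lemma egf_mult: "egf f * egf g = egf (\<lambda>n. \<Sum>k\<le>n. of_nat (n choose k) * f k * g (n - k))"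
proof (rule fps_ext)
  fix n
  have "f k / fact k * (g (n - k) / fact (n - k)) = of_nat (n choose k) * f k * g (n - k) / fact n"
    if "k \<le> n" for k
    using that by (simp add: binomial_fact)
  then show "(egf f * egf g) $ n = egf (\<lambda>n. \<Sum>k\<le>n. of_nat (n choose k) * f k * g (n - k)) $ n"
    by (simp add: fps_mult_nth atLeast0AtMost sum_divide_distrib)
qed

definition rescale :: "rat \<Rightarrow> rat fps \<Rightarrow> rat fps" where
  "rescale c f = f oo (fps_const c * fps_X)"

lemma rescale_egf: "rescale c (egf f) = egf (\<lambda>n. c ^ n * f n)"
  by (simp add: rescale_def fps_compose_linear fps_eq_iff)

lemma rescale_mult: "rescale c (f * g) = rescale c f * rescale c g"
  by (simp add: rescale_def fps_compose_mult_distrib)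

lemma rescale_add: "rescale c (f + g) = rescale c f + rescale c g"
  and rescale_diff: "rescale c (f - g) = rescale c f - rescale c g"
  by (simp_all add: rescale_def fps_compose_add_distrib fps_compose_sub_distrib)

lemma rescale_exp: "rescale c (fps_exp d) = fps_exp (c * d)"
  unfolding egf_power [symmetric] rescale_egf egf_eq_iff by (simp add: power_mult_distrib)

lemma rescale_const: "rescale c (fps_const d) = fps_const d"
  by (simp add: rescale_def)

lemma rescale_numeral: "rescale c (numeral w) = numeral w" and rescale_1: "rescale c 1 = 1"
  using rescale_const[of c "numeral w"] rescale_const[of c 1] by (simp_all add: numeral_fps_const)

lemma rescale_X: "rescale c fps_X = fps_const c * fps_X"
  by (simp add: rescale_def)

lemmas rescale_simps = rescale_mult rescale_add rescale_diff rescale_exp rescale_numeral rescale_1 rescale_X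

text \<open>This series has constant term 0 and no inverse. Generating function identities are
  therefore kept in multiplied form, and the factor is cancelled in the integral domain of power
  series.\<close>

lemma exp_minus_1_nonzero: "fps_exp (1 :: rat) - 1 \<noteq> 0"
  by simp

lemma exp_plus_1_nonzero: "fps_exp (c :: rat) + 1 \<noteq> 0"
proof
  assume "fps_exp c + 1 = 0"
  then have "(fps_exp c + 1) $ 0 = 0" by simp
  then show False by simp
qed

lemma exp_add: "fps_exp (a :: rat) * fps_exp b = fps_exp (a + b)"
  by (simp add: fps_exp_add_mult)

subsection \<open>Bernoulli polynomials\<close>

lemma egf_bernoulli_num: "egf bernoulli_num * (fps_exp 1 - 1) = fps_X"
proof -
  have "egf bernoulli_num * (fps_exp 1 - 1) = egf bernoulli_num * egf (\<lambda>n. 1 ^ n) - egf bernoulli_num"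
    unfolding egf_power by (simp add: algebra_simps)
  also have "\<dots> = egf (\<lambda>n. (\<Sum>k\<le>n. of_nat (n choose k) * bernoulli_num k) - bernoulli_num n)"
    unfolding egf_mult egf_diff by simp
  also have "\<dots> = fps_X"
  proof (rule fps_ext)
    fix n
    have "(\<Sum>k\<le>n. of_nat (n choose k) * bernoulli_num k) - bernoulli_num n = (if n = 1 then 1 else 0)"
    proof (cases n)
      case (Suc m)
      have "(\<Sum>k\<le>n. of_nat (n choose k) * bernoulli_num k) - bernoulli_num n
          = (\<Sum>k=0..n-1. of_nat (n choose k) * bernoulli_num k)"
        by (simp add: Suc atLeast0AtMost)
      also have "\<dots> = (if n = 1 then 1 else 0)"
        using bernoulli_num_sum[of n] by (cases "n = 1") (auto simp: Suc bernoulli_num_0)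
      finally show ?thesis .
    qed simp
    then show "egf (\<lambda>n. (\<Sum>k\<le>n. of_nat (n choose k) * bernoulli_num k) - bernoulli_num n) $ n = fps_X $ n"
      by (simp add: fps_X_nth)
  qed
  finally show ?thesis .
qed

lemma egf_bernoulli_poly: "egf (\<lambda>n. bernoulli_poly n x) = egf bernoulli_num * fps_exp x"
  unfolding egf_power [symmetric] egf_mult by (simp add: egf_eq_iff bernoulli_poly_def atLeast0AtMost)

lemma bernoulli_poly_0: "bernoulli_poly n 0 = bernoulli_num n"
  using egf_bernoulli_poly[of 0] by (simp add: egf_eq_iff)

lemma bernoulli_poly_plus_1: "bernoulli_poly n (x + 1) = bernoulli_poly n x + of_nat n * x ^ (n - 1)"
proof -
  have "egf (\<lambda>n. bernoulli_poly n (x + 1)) = egf (\<lambda>n. bernoulli_poly n x) + fps_X * fps_exp x"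
    unfolding egf_bernoulli_poly egf_bernoulli_num [symmetric] fps_exp_add_mult
    by (simp add: algebra_simps)
  also have "fps_X * fps_exp x = egf (\<lambda>n. of_nat n * x ^ (n - 1))"
  proof (rule fps_ext)
    show "(fps_X * fps_exp x) $ n = egf (\<lambda>n. of_nat n * x ^ (n - 1)) $ n" for n
      by (cases n) (simp_all del: of_nat_Suc)
  qed
  finally show ?thesis by (simp add: egf_add egf_eq_iff)
qed

text \<open>Changing the sign of the variable in \<open>t / (exp t - 1)\<close> amounts to
  multiplication by \<open>exp t\<close>.\<close>

lemma bernoulli_poly_reflect: "bernoulli_poly n (1 - x) = (-1) ^ n * bernoulli_poly n x"
proof -
  define B where "B = egf bernoulli_num"
  have "rescale (-1) B * (fps_exp (-1) - 1) = - fps_X"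
    using arg_cong[OF egf_bernoulli_num, of "rescale (-1)"] by (simp add: rescale_simps B_def)
  then have "rescale (-1) B * (fps_exp (-1) - 1) * fps_exp 1 = - (B * fps_exp 1 * (fps_exp 1 - 1))"
    using egf_bernoulli_num by (simp add: B_def mult_ac)
  moreover have "rescale (-1) B * (fps_exp (-1) - 1) * fps_exp 1 = - (rescale (-1) B * (fps_exp 1 - 1))"
    by (simp add: left_diff_distrib right_diff_distrib mult.assoc exp_add)
  ultimately have "rescale (-1) B * (fps_exp 1 - 1) = B * fps_exp 1 * (fps_exp 1 - 1)"
    by simp
  then have *: "rescale (-1) B = B * fps_exp 1" using exp_minus_1_nonzero by (simp only: mult_cancel_right) simp
  have "egf (\<lambda>n. bernoulli_poly n (1 - x)) = rescale (-1) (egf (\<lambda>n. bernoulli_poly n x))"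
    unfolding egf_bernoulli_poly rescale_simps B_def [symmetric] * by (simp add: mult.assoc exp_add)
  then show ?thesis by (simp add: rescale_egf egf_eq_iff)
qed

lemma bernoulli_num_odd: "odd n \<Longrightarrow> n > 1 \<Longrightarrow> bernoulli_num n = 0"
  using bernoulli_poly_reflect[of n 0] bernoulli_poly_plus_1[of n 0]
  by (simp add: bernoulli_poly_0 zero_power)

text \<open>Raabe's multiplication theorem at argument 0: the geometric sum of
  \<open>fps_exp k\<close> over \<open>k < m\<close> is the quotient of \<open>fps_exp m - 1\<close>
  by \<open>fps_exp 1 - 1\<close>, which replaces the denominator of the rescaled series by the
  original one.\<close>

lemma bernoulli_poly_multiplication:
  assumes "m > 0"
  shows "of_nat m ^ n * (\<Sum>k<m. bernoulli_poly n (of_nat k / of_nat m)) = of_nat m * bernoulli_num n"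
proof -
  define B M where "B = egf bernoulli_num" and "M = (of_nat m :: rat)"
  have M: "M \<noteq> 0" using assms by (simp add: M_def)
  define S where "S = (\<Sum>k<m. fps_exp (of_nat k :: rat))"
  have S: "S * (fps_exp 1 - 1) = fps_exp M - 1"
    using power_diff_1_eq[of "fps_exp (1 :: rat)" m] by (simp add: S_def M_def fps_exp_power_mult mult.commute)
  have "rescale M B * S * (fps_exp 1 - 1) = rescale M (B * (fps_exp 1 - 1))"
    by (simp add: rescale_simps mult.assoc S)
  also have "\<dots> = fps_const M * B * (fps_exp 1 - 1)"
    by (simp add: B_def egf_bernoulli_num rescale_simps mult.assoc)
  finally have *: "rescale M B * S = fps_const M * B" using exp_minus_1_nonzero by (simp only: mult_cancel_right) simp
  have "(\<Sum>k<m. rescale M (egf (\<lambda>n. bernoulli_poly n (of_nat k / M)))) = rescale M B * S"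
    unfolding egf_bernoulli_poly S_def sum_distrib_left B_def using M
    by (simp add: rescale_simps)
  also have "\<dots> = egf (\<lambda>n. M * bernoulli_num n)"
    unfolding * by (simp add: fps_eq_iff B_def)
  finally show ?thesis by (simp add: rescale_egf egf_sum egf_eq_iff M_def sum_distrib_left)
qed

subsection \<open>Euler polynomials and the numbers U and s\<close>

text \<open>The bracket is the coefficient of \<open>fps_exp 1 + fps_exp (-1)\<close>, that is, of
  twice the hyperbolic cosine. The power of 1 is kept so that the left side matches what
  \<open>egf_power\<close> and \<open>egf_mult\<close> produce.\<close>

lemma sum_even_differences:
  fixes f :: "nat \<Rightarrow> rat"
  shows "(\<Sum>k\<le>n. of_nat (n choose k) * f k * (1 ^ (n - k) + (-1) ^ (n - k)))
    = 2 * (\<Sum>j=0..n div 2. of_nat (n choose (2 * j)) * f (n - 2 * j))"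
proof -
  have "(\<Sum>k\<le>n. of_nat (n choose k) * f k * (1 ^ (n - k) + (-1) ^ (n - k)))
      = (\<Sum>i\<le>n. of_nat (n choose i) * f (n - i) * (1 + (-1) ^ i))"
    by (rule sum.reindex_bij_witness[of _ "\<lambda>k. n - k" "\<lambda>k. n - k"])
      (auto simp: binomial_symmetric [symmetric])
  also have "\<dots> = (\<Sum>i | i \<le> n \<and> even i. of_nat (n choose i) * f (n - i) * (1 + (-1) ^ i))"
    by (rule sum.mono_neutral_right) auto
  also have "\<dots> = (\<Sum>j=0..n div 2. 2 * (of_nat (n choose (2 * j)) * f (n - 2 * j)))"
    by (rule sum.reindex_bij_witness[of _ "\<lambda>j. 2 * j" "\<lambda>i. i div 2"]) auto
  finally show ?thesis by (simp add: sum_distrib_left)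
qed

lemma egf_mult_exp_plus_exp_minus:
  "egf f * (fps_exp 1 + fps_exp (-1))
     = egf (\<lambda>n. 2 * (\<Sum>j=0..n div 2. of_nat (n choose (2 * j)) * f (n - 2 * j)))"
  unfolding egf_power [symmetric] egf_add egf_mult sum_even_differences ..

lemma euler_num_odd: "odd n \<Longrightarrow> euler_num n = 0"
  by (subst euler_num.simps) (simp add: odd_pos)

lemma egf_euler_num: "egf (\<lambda>n. of_int (euler_num n)) * (fps_exp 1 + fps_exp (-1)) = 2"
  unfolding egf_mult_exp_plus_exp_minus
proof (rule fps_ext)
  fix n
  have "(\<Sum>j=0..n div 2. int (n choose (2 * j)) * euler_num (n - 2 * j)) = (if n = 0 then 1 else 0)"
  proof (cases "odd n")
    case True
    then have "euler_num (n - 2 * j) = 0" if "j \<le> n div 2" for j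
      using that by (intro euler_num_odd) auto
    then show ?thesis using odd_pos[OF True] by simp
  next
    case False
    then show ?thesis using euler_num.simps[of n]
      by (subst sum.atLeast_Suc_atMost) auto
  qed
  from arg_cong[OF this, of "of_int :: int \<Rightarrow> rat"]
  have "(\<Sum>j=0..n div 2. of_nat (n choose (2 * j)) * of_int (euler_num (n - 2 * j))) = (if n = 0 then 1 else 0 :: rat)"
    by simp
  then show "egf (\<lambda>n. 2 * (\<Sum>j=0..n div 2. of_nat (n choose (2 * j)) * of_int (euler_num (n - 2 * j)))) $ n = 2 $ n"
    by (simp add: numeral_fps_const)
qed

lemma U_num_odd: "odd n \<Longrightarrow> U_num n = 0"
  by (subst U_num.simps) (simp add: odd_pos)

lemma egf_U_num: "egf (\<lambda>n. of_int (U_num n)) * (fps_exp 1 + fps_exp (-1) - 1) = 1"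
proof -
  have "egf (\<lambda>n. of_int (U_num n)) * (fps_exp 1 + fps_exp (-1)) = egf (\<lambda>n. of_int (U_num n)) + 1"
    unfolding egf_mult_exp_plus_exp_minus
  proof (rule fps_ext)
    fix n
    have "2 * (\<Sum>j=0..n div 2. int (n choose (2 * j)) * U_num (n - 2 * j)) = U_num n + (if n = 0 then 1 else 0)"
    proof (cases "odd n")
      case True
      then have "U_num (n - 2 * j) = 0" if "j \<le> n div 2" for j
        using that by (intro U_num_odd) auto
      then show ?thesis using odd_pos[OF True] U_num_odd[OF True] by simp
    next
      case False
      then show ?thesis using U_num.simps[of n]
        by (subst sum.atLeast_Suc_atMost) auto
    qed
    from arg_cong[OF this, of "of_int :: int \<Rightarrow> rat"]
    have "2 * (\<Sum>j=0..n div 2. of_nat (n choose (2 * j)) * of_int (U_num (n - 2 * j)))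
        = (of_int (U_num n) + (if n = 0 then 1 else 0) :: rat)"
      by simp
    then show "egf (\<lambda>n. 2 * (\<Sum>j=0..n div 2. of_nat (n choose (2 * j)) * of_int (U_num (n - 2 * j)))) $ n
        = (egf (\<lambda>n. of_int (U_num n)) + 1) $ n"
      by simp
  qed
  then show ?thesis by (simp add: algebra_simps)
qed

lemma egf_euler_poly: "egf (\<lambda>n. euler_poly n x) * (fps_exp 1 + 1) = 2 * fps_exp x"
proof -
  define E where "E = egf (\<lambda>n. of_int (euler_num n))"
  have "egf (\<lambda>n. euler_poly n x) = rescale (1/2) (E * fps_exp (2 * x - 1))"
    unfolding egf_power [symmetric] E_def egf_mult rescale_egf
    by (simp add: egf_eq_iff euler_poly_def atLeast0AtMost power_one_over mult_ac)
  then have e: "egf (\<lambda>n. euler_poly n x) = rescale (1/2) E * fps_exp (x - 1/2)"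
    by (simp add: rescale_simps algebra_simps)
  have "rescale (1/2) E * (fps_exp (1/2) + fps_exp (-1/2)) = 2"
    using arg_cong[OF egf_euler_num, of "rescale (1/2)"] by (simp add: rescale_simps E_def)
  then have "2 * fps_exp x = rescale (1/2) E * (fps_exp (1/2) + fps_exp (-1/2)) * fps_exp x" by simp
  also have "\<dots> = rescale (1/2) E * fps_exp (x - 1/2) * (fps_exp 1 + 1)"
    by (simp add: distrib_left distrib_right mult.assoc exp_add add.commute)
  finally show ?thesis unfolding e by simp
qed

lemma egf_euler_polyI:
  assumes "F * (fps_exp 1 + 1) = 2 * fps_exp x"
  shows "F = egf (\<lambda>n. euler_poly n x)"
proof -
  have "F * (fps_exp 1 + 1) = egf (\<lambda>n. euler_poly n x) * (fps_exp 1 + 1)"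
    using assms egf_euler_poly by simp
  then show ?thesis using exp_plus_1_nonzero by (simp only: mult_cancel_right) simp
qed

lemma euler_poly_plus_1: "euler_poly n (x + 1) + euler_poly n x = 2 * x ^ n"
proof -
  have "egf (\<lambda>n. euler_poly n x) * fps_exp 1 = egf (\<lambda>n. euler_poly n (x + 1))"
    by (rule egf_euler_polyI) (use egf_euler_poly[of x] in \<open>simp add: fps_exp_add_mult mult_ac\<close>)
  then have "egf (\<lambda>n. euler_poly n (x + 1)) + egf (\<lambda>n. euler_poly n x) = 2 * egf (\<lambda>n. x ^ n)"
    using egf_euler_poly[of x] by (simp add: egf_power algebra_simps)
  also have "\<dots> = egf (\<lambda>n. 2 * x ^ n)" by (simp add: fps_eq_iff numeral_fps_const)
  finally show ?thesis by (simp add: egf_add egf_eq_iff)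
qed

lemma euler_poly_reflect: "euler_poly n (1 - x) = (-1) ^ n * euler_poly n x"
proof -
  have "rescale (-1) (egf (\<lambda>n. euler_poly n x)) * (fps_exp (-1) + 1) = 2 * fps_exp (- x)"
    using arg_cong[OF egf_euler_poly, of "rescale (-1)"] by (simp add: rescale_simps)
  from arg_cong[OF this, of "\<lambda>f. f * fps_exp 1"]
  have "rescale (-1) (egf (\<lambda>n. euler_poly n x)) * (fps_exp 1 + 1) = 2 * fps_exp (1 - x)"
    by (simp add: distrib_left distrib_right mult.assoc exp_add add.commute)
  from egf_euler_polyI[OF this] show ?thesis by (simp add: rescale_egf egf_eq_iff)
qed

text \<open>The values at 0 and 1 are equal by reflection and opposite by the difference
  equation.\<close>

lemma euler_poly_even_0: "even n \<Longrightarrow> n > 0 \<Longrightarrow> euler_poly n 0 = 0"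
  using euler_poly_plus_1[of n 0] euler_poly_reflect[of n 0] by simp

lemma euler_poly_half: "2 ^ n * euler_poly n (1/2) = of_int (euler_num n)"
proof -
  have "(\<Sum>k=0..n. of_nat (n choose k) * 0 ^ (n - k) * of_int (euler_num k)) =
      (\<Sum>k\<in>{n}. of_nat (n choose k) * 0 ^ (n - k) * of_int (euler_num k) :: rat)"
    by (rule sum.mono_neutral_right) auto
  then show ?thesis by (simp add: euler_poly_def)
qed

text \<open>The factorization \<open>z^3 + 1 = (z + 1) * (z^2 - z + 1)\<close> at
  \<open>z = exp t\<close> makes the series of the Euler polynomials at 1/3, taken at
  \<open>3 * t\<close>, the product of the series of \<open>U_num\<close> and of the Euler
  polynomials at 0.\<close>

lemma U_num_euler_poly:
  assumes "even n"
  shows "of_int (U_num n) = 3 ^ n * euler_poly n (1/3)"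
proof -
  define U where "U = egf (\<lambda>n. of_int (U_num n))"
  define E where "E = egf (\<lambda>n. euler_poly n 0)"
  define F where "F = rescale 3 (egf (\<lambda>n. euler_poly n (1/3)))"
  define z where "z = fps_exp (1 :: rat)"
  have z3: "fps_exp 3 = z ^ 3" by (simp add: z_def fps_exp_power_mult)
  have zz: "z * fps_exp (-1) = 1" by (simp add: z_def exp_add)
  have F: "F * (z ^ 3 + 1) = 2 * z"
    using arg_cong[OF egf_euler_poly[of "1/3"], of "rescale 3"]
    by (simp add: rescale_simps F_def z3 z_def)
  have "U * (z + fps_exp (-1) - 1) * z = z"
    using egf_U_num by (simp add: U_def z_def)
  then have U: "U * (z ^ 2 + 1 - z) = z"
    using zz by (simp add: algebra_simps power2_eq_square)
  have E: "E * (z + 1) = 2" using egf_euler_poly[of 0] by (simp add: E_def z_def)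
  have "U * E * (z ^ 3 + 1) = (U * (z ^ 2 + 1 - z)) * (E * (z + 1))"
    by (simp add: algebra_simps power2_eq_square power3_eq_cube)
  also have "\<dots> = F * (z ^ 3 + 1)" unfolding U E F by simp
  finally have "U * E = F" using exp_plus_1_nonzero[of 3] by (simp only: mult_cancel_right z3) simp
  then have "3 ^ n * euler_poly n (1/3) = (\<Sum>k\<le>n. of_nat (n choose k) * of_int (U_num k) * euler_poly (n - k) 0)"
    unfolding U_def E_def F_def egf_mult rescale_egf egf_eq_iff by simp
  \<comment> \<open>For \<open>n\<close> even and \<open>k < n\<close> one factor is zero:
    \<open>U_num k\<close> if \<open>k\<close> is odd, and the Euler polynomial of even positive
    index \<open>n - k\<close> at 0 if \<open>k\<close> is even.\<close>
  also have "\<dots> = (\<Sum>k\<in>{n}. of_nat (n choose k) * of_int (U_num k) * euler_poly (n - k) 0)"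
  proof (rule sum.mono_neutral_right)
    show "\<forall>i\<in>{..n} - {n}. of_nat (n choose i) * of_int (U_num i) * euler_poly (n - i) 0 = 0"
    proof
      fix i assume i: "i \<in> {..n} - {n}"
      show "of_nat (n choose i) * of_int (U_num i) * euler_poly (n - i) 0 = 0"
        using i assms by (cases "even i") (auto simp: U_num_odd euler_poly_even_0)
    qed
  qed auto
  also have "\<dots> = of_int (U_num n)" by (simp add: euler_poly_def euler_num.simps)
  finally show ?thesis by simp
qed

text \<open>Divided by \<open>4 ^ n\<close>, the recursion of \<open>s_num\<close> becomes the
  coefficient form of the equation that characterizes the Euler polynomials at 1/4.\<close>

lemma s_num_euler_poly: "of_int (s_num n) = 4 ^ n * euler_poly n (1/4)"
proof -
  define f :: "nat \<Rightarrow> rat" where "f n = of_int (s_num n) / 4 ^ n" for n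
  have f: "(\<Sum>k\<le>n. of_nat (n choose k) * f k) + f n = 2 * (1/4) ^ n" for n
  proof (cases "n = 0")
    case True
    then show ?thesis by (simp add: f_def s_num.simps)
  next
    case False
    have "(2 :: rat) ^ (2 * n - 1 - 2 * k) = 4 ^ n / (2 * 4 ^ k)" if "k < n" for k
    proof -
      have q: "(2 :: rat) ^ (2 * j) = 4 ^ j" for j by (simp add: power_mult)
      have "2 * 2 ^ (2 * k) * (2 :: rat) ^ (2 * n - 1 - 2 * k) = 2 ^ (2 * n)"
        using that by (simp flip: power_Suc power_add)
      then show ?thesis unfolding q by (simp add: field_simps)
    qed
    then have "(\<Sum>k<n. of_nat (n choose k) * 2 ^ (2*n - 1 - 2*k) * of_int (s_num k))
        = 4 ^ n / 2 * (\<Sum>k<n. of_nat (n choose k) * f k)"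
      unfolding sum_distrib_left by (intro sum.cong) (auto simp: f_def)
    moreover have "of_int (s_num n) = (1 - (\<Sum>k<n. of_nat (n choose k) * 2 ^ (2*n - 1 - 2*k) * of_int (s_num k)) :: rat)"
      using False by (subst s_num.simps) simp
    ultimately have "of_int (s_num n) = 1 - 4 ^ n / 2 * (\<Sum>k<n. of_nat (n choose k) * f k)" by simp
    then have "4 ^ n * f n = 1 - 4 ^ n / 2 * (\<Sum>k<n. of_nat (n choose k) * f k)"
      by (simp add: f_def)
    then have "(\<Sum>k<n. of_nat (n choose k) * f k) + 2 * f n = 2 / 4 ^ n"
      by (simp add: field_simps)
    then show ?thesis by (simp add: lessThan_Suc_atMost [symmetric] power_one_over)
  qed
  have "egf f * (fps_exp 1 + 1) = egf f * egf (\<lambda>n. 1 ^ n) + egf f"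
    by (simp only: egf_power distrib_left mult_1_right)
  also have "\<dots> = egf (\<lambda>n. 2 * (1/4) ^ n)"
    unfolding egf_mult egf_add using f by simp
  also have "\<dots> = 2 * fps_exp (1/4)"
    by (simp add: fps_eq_iff numeral_fps_const)
  finally have "egf f = egf (\<lambda>n. euler_poly n (1/4))" by (rule egf_euler_polyI)
  then have "f n = euler_poly n (1/4)" by (simp add: egf_eq_iff)
  then show ?thesis by (simp add: f_def field_simps)
qed

text \<open>The tripling formula of the Euler polynomials at 1/6 involves the arguments 1/6, 1/2,
  5/6 and comes from \<open>z^6 + 1 = (z^2 + 1) * (z^4 - z^2 + 1)\<close> with
  \<open>z = exp (t / 2)\<close>. For even \<open>n\<close> reflection identifies the values at 1/6
  and 5/6.\<close>

lemma euler_poly_sixth: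
  assumes "even n"
  shows "2 * 6 ^ n * euler_poly n (1/6) = (3 ^ n + 1) * of_int (euler_num n)"
proof -
  define F where "F x = rescale 3 (egf (\<lambda>n. euler_poly n x))" for x
  define z where "z = fps_exp (1/2 :: rat)"
  have zp: "fps_exp 1 = z ^ 2" "fps_exp 3 = z ^ 6" "fps_exp (1/2) = z" "fps_exp (3/2) = z ^ 3" "fps_exp (5/2) = z ^ 5"
    by (simp_all add: z_def fps_exp_power_mult)
  have F: "F x * (fps_exp 3 + 1) = 2 * fps_exp (3 * x)" for x
    using arg_cong[OF egf_euler_poly[of x], of "rescale 3"] by (simp add: rescale_simps F_def)
  have "(F (1/6) + F (5/6) - F (1/2)) * (z ^ 6 + 1) = 2 * z + 2 * z ^ 5 - 2 * z ^ 3"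
    using F[of "1/6"] F[of "5/6"] F[of "1/2"] by (simp add: distrib_right left_diff_distrib zp)
  then have "(F (1/6) + F (5/6) - F (1/2)) * (z ^ 2 + 1) * (z ^ 4 - z ^ 2 + 1) = 2 * z * (z ^ 4 - z ^ 2 + 1)"
    by (simp add: algebra_simps power_numeral_reduce)
  moreover have "z ^ 4 - z ^ 2 + 1 \<noteq> 0"
  proof
    assume "z ^ 4 - z ^ 2 + 1 = 0"
    then have "(z ^ 4 - z ^ 2 + 1) $ 0 = 0" by simp
    then show False by (simp add: z_def fps_exp_power_mult)
  qed
  ultimately have "(F (1/6) + F (5/6) - F (1/2)) * (fps_exp 1 + 1) = 2 * fps_exp (1/2)"
    unfolding zp by (simp only: mult_cancel_right) simp
  then have "F (1/6) + F (5/6) - F (1/2) = egf (\<lambda>n. euler_poly n (1/2))" by (rule egf_euler_polyI)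
  then have "3 ^ n * euler_poly n (1/6) + 3 ^ n * euler_poly n (5/6) - 3 ^ n * euler_poly n (1/2) = euler_poly n (1/2)"
    unfolding F_def rescale_egf egf_add egf_diff egf_eq_iff by simp
  moreover have "euler_poly n (5/6) = euler_poly n (1/6)"
    using euler_poly_reflect[of n "1/6"] assms by simp
  ultimately have "2 * 3 ^ n * euler_poly n (1/6) = (3 ^ n + 1) * euler_poly n (1/2)"
    by (simp add: algebra_simps)
  from arg_cong[OF this, of "\<lambda>t. 2 ^ n * t"]
  have "2 * (2 ^ n * 3 ^ n) * euler_poly n (1/6) = (3 ^ n + 1) * (2 ^ n * euler_poly n (1/2))"
    by (simp add: algebra_simps)
  then show ?thesis unfolding euler_poly_half power_mult_distrib [symmetric] by simp
qed

subsection \<open>The quotient T and the congruence for G\<close>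

text \<open>Division by \<open>n\<close> is absorbed through
  \<open>n choose k = n / k * ((n - 1) choose (k - 1))\<close>. So the factors \<open>p\<close> of
  \<open>n = N\<close> disappear, and each term is an integer times a Bernoulli number times
  \<open>y ^ k / k\<close>, which can be estimated separately.\<close>

lemma bernoulli_poly_minus_bernoulli_num:
  assumes "n > 0"
  shows "(bernoulli_poly n y - bernoulli_num n) / of_nat n
    = (\<Sum>k=1..n. of_nat ((n - 1) choose (k - 1)) * (bernoulli_num (n - k) * (y ^ k / of_nat k)))"
proof -
  have "bernoulli_poly n y = (\<Sum>k=0..n. of_nat (n choose k) * bernoulli_num (n - k) * y ^ k)"
    unfolding bernoulli_poly_def
    by (rule sum.reindex_bij_witness[of _ "\<lambda>k. n - k" "\<lambda>k. n - k"])
      (auto simp: binomial_symmetric [symmetric])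
  then have "bernoulli_poly n y - bernoulli_num n = (\<Sum>k=1..n. of_nat (n choose k) * bernoulli_num (n - k) * y ^ k)"
    by (simp add: sum.atLeast_Suc_atMost)
  also have "\<dots> = of_nat n * (\<Sum>k=1..n. of_nat ((n - 1) choose (k - 1)) * (bernoulli_num (n - k) * (y ^ k / of_nat k)))"
    unfolding sum_distrib_left
  proof (rule sum.cong[OF refl])
    fix k assume "k \<in> {1..n}"
    then obtain j where j: "k = Suc j" by (cases k) auto
    have "of_nat (Suc j) * of_nat (n choose Suc j) = (of_nat n * of_nat ((n - 1) choose j) :: rat)"
      by (metis binomial_absorption of_nat_mult)
    then have "of_nat (n choose Suc j) = (of_nat n * of_nat ((n - 1) choose j) / of_nat (Suc j) :: rat)"
      by (simp add: field_simps del: of_nat_Suc)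
    then show "of_nat (n choose k) * bernoulli_num (n - k) * y ^ k
        = of_nat n * (of_nat ((n - 1) choose (k - 1)) * (bernoulli_num (n - k) * (y ^ k / of_nat k)))"
      by (simp add: j del: of_nat_Suc)
  qed
  finally show ?thesis using assms by simp
qed

lemma bernoulli_poly_telescope:
  "bernoulli_poly n (of_nat m) - bernoulli_num n = of_nat n * (\<Sum>j<m. of_nat j ^ (n - 1))"
proof (induction m)
  case (Suc m)
  have "bernoulli_poly n (of_nat (Suc m)) = bernoulli_poly n (of_nat m) + of_nat n * of_nat m ^ (n - 1)"
    using bernoulli_poly_plus_1[of n "of_nat m"] by (simp add: add.commute)
  then show ?case using Suc by (simp add: algebra_simps)
qed (simp add: bernoulli_poly_0)

text \<open>\<open>A\<close> agrees modulo \<open>p^3\<close> with the exponential of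
  \<open>L\<close>. For \<open>p > 3\<close> the cubic term \<open>L^3 / 6\<close> is already
  divisible by \<open>p^3\<close>, as \<open>p\<close> divides \<open>L\<close>.\<close>

definition exp_cong :: "nat \<Rightarrow> rat \<Rightarrow> rat \<Rightarrow> bool" where
  "exp_cong p L A \<longleftrightarrow> pdiv p 1 L \<and> pdiv p 3 (1 + L + L\<^sup>2 / 2 - A)"

text \<open>A \<open>p\<close>-adic logarithm in disguise: \<open>dev p a / p\<^sup>2\<close> is congruent to
  \<open>log (a ^ (p - 1))\<close> modulo \<open>p ^ 3\<close>, because \<open>p\<^sup>2 * (p - 1)\<close> is the totient of \<open>p ^ 3\<close>.\<close>

definition dev :: "nat \<Rightarrow> nat \<Rightarrow> rat" where
  "dev p a = 1 - (1 / of_nat a) ^ (p\<^sup>2 * (p - 1))"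

context
  fixes p :: nat
  assumes p: "prime p" and p3: "p > 3"
begin

lemma p_pos: "p > 0"
  using p3 by simp

lemma p_odd: "odd p"
  using p p3 prime_odd_nat by simp

lemma pdiv_p_self: "pdiv p 1 (of_nat p)"
  using pdiv_p[of 1 p] by simp

lemma half_Zp: "1 / 2 \<in> Zp p"
  using Zp_inverse_less[OF p, of 2] p3 by simp

lemma third_Zp: "1 / 3 \<in> Zp p"
  using Zp_inverse_less[OF p, of 3] p3 by simp

section \<open>Bernoulli numbers modulo powers of \<open>p\<close>\<close>

lemma pdiv_power_p_div:
  assumes "m \<le> 3" "m \<le> k" "k > 0"
  shows "pdiv p m (of_nat p ^ k / of_nat k)"
proof -
  obtain a b where ab: "\<not> p dvd b" "k = b * p ^ a"
    using prime_power_canonical[OF p, of k] assms by blast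
  have b: "1 / of_nat b \<in> Zp p" using ab by (intro Zp_inverse_of_nat[OF p])
  have ak: "a + m \<le> k"
  proof (cases a)
    case (Suc c)
    \<comment> \<open>The denominator \<open>k\<close> costs \<open>a\<close> factors
      \<open>p\<close>. If \<open>a > 0\<close>, then \<open>k\<close> is at least
      \<open>p ^ a\<close> and so exceeds \<open>a\<close> by at least 3; this is where the bound
      \<open>m \<le> 3\<close> enters.\<close>
    have "a + 3 \<le> 4 ^ a" unfolding Suc by (induction c) auto
    also have "\<dots> \<le> p ^ a" using p3 by (intro power_mono) auto
    also have "\<dots> \<le> b * p ^ a" using ab assms by (cases b) auto
    finally show ?thesis using assms ab by simp
  qed (use assms in simp)
  have "of_nat p ^ k / of_nat k = (of_nat p ^ (k - a) * (of_nat p ^ a)) / (of_nat b * of_nat p ^ a :: rat)"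
    using ak by (simp add: ab(2) power_add [symmetric])
  also have "\<dots> = of_nat p ^ (k - a) * (1 / of_nat b)" using p_pos by simp
  finally have "pdiv p (k - a) (of_nat p ^ k / of_nat k)" using pdivI[OF b] by simp
  then show ?thesis by (rule pdiv_mono) (use ak in simp)
qed

lemma pdiv_power_div:
  assumes y: "pdiv p 1 y" and "m \<le> 3" "m \<le> k" "k > 0"
  shows "pdiv p m (y ^ k / of_nat k)"
proof -
  obtain c where c: "c \<in> Zp p" "y = of_nat p * c" using y unfolding pdiv_def by auto
  have e: "y ^ k / of_nat k = of_nat p ^ k / of_nat k * c ^ k" by (simp add: c power_mult_distrib)
  show ?thesis unfolding e
    by (rule pdiv_scale_right[OF pdiv_power_p_div[OF assms(2-4)] Zp_power[OF c(1)]])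
qed

text \<open>For \<open>b\<close> a Bernoulli number: its denominator contains \<open>p\<close> at
  most once, so one power of \<open>p\<close> is lost.\<close>

lemma pdiv_mult_pole:
  assumes "of_nat p * b \<in> Zp p" "pdiv p (Suc m) z"
  shows "pdiv p m (b * z)"
proof -
  have "pdiv p m (z / of_nat p)" using pdiv_div[of p m 1 z] assms(2) p_pos by simp
  from pdiv_scale[OF this assms(1)] show ?thesis using p_pos by simp
qed

lemma sum_powers_bernoulli:
  "(\<Sum>j<p. of_nat j ^ n) = of_nat p * bernoulli_num n
     + (\<Sum>k=2..Suc n. of_nat (n choose (k - 1)) * (bernoulli_num (Suc n - k) * (of_nat p ^ k / of_nat k)))"
proof -
  have "(\<Sum>j<p. of_nat j ^ n) = (bernoulli_poly (Suc n) (of_nat p) - bernoulli_num (Suc n)) / of_nat (Suc n)"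
    by (simp add: bernoulli_poly_telescope del: of_nat_Suc)
  also have "\<dots> = (\<Sum>k=1..Suc n. of_nat (n choose (k - 1)) * (bernoulli_num (Suc n - k) * (of_nat p ^ k / of_nat k)))"
    using bernoulli_poly_minus_bernoulli_num[of "Suc n"] by simp
  also have "\<dots> = of_nat p * bernoulli_num n
     + (\<Sum>k=2..Suc n. of_nat (n choose (k - 1)) * (bernoulli_num (Suc n - k) * (of_nat p ^ k / of_nat k)))"
    by (subst sum.atLeast_Suc_atMost) (auto simp: numeral_2_eq_2 simp del: sum.cl_ivl_Suc)
  finally show ?thesis .
qed

text \<open>A weak form of the von Staudt-Clausen theorem. In the power sum formula the terms after
  \<open>p * bernoulli_num n\<close> contain earlier Bernoulli numbers, whose simple pole still
  leaves one factor \<open>p\<close>, as \<open>p ^ k / k\<close> is divisible by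
  \<open>p^2\<close>.\<close>

lemma p_bernoulli_num:
  "of_nat p * bernoulli_num n \<in> Zp p \<and> pdiv p 1 (of_nat p * bernoulli_num n - (\<Sum>j<p. of_nat j ^ n))"
proof (induction n rule: less_induct)
  case (less n)
  have "pdiv p 1 (\<Sum>k=2..Suc n. of_nat (n choose (k - 1)) * (bernoulli_num (Suc n - k) * (of_nat p ^ k / of_nat k)))"
  proof (intro pdiv_sum pdiv_scale[of p _ _ "of_nat _"] Zp_of_nat)
    fix k assume k: "k \<in> {2..Suc n}"
    then have "pdiv p (Suc 1) (of_nat p ^ k / of_nat k)" by (intro pdiv_power_p_div) auto
    then show "pdiv p 1 (bernoulli_num (Suc n - k) * (of_nat p ^ k / of_nat k))"
      using less[of "Suc n - k"] k by (intro pdiv_mult_pole) auto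
  qed
  then have *: "pdiv p 1 ((\<Sum>j<p. of_nat j ^ n) - of_nat p * bernoulli_num n)"
    by (simp add: sum_powers_bernoulli)
  have "(\<Sum>j<p. of_nat j ^ n) \<in> Zp p" by (intro Zp_sum Zp_power) simp
  from Zp_diff[OF this pdiv_Zp[OF *]] show ?case using pdiv_sym[OF *] by simp
qed

abbreviation (input) N :: nat where "N \<equiv> p\<^sup>2 * (p - 1)"

lemma N: "even N" "N > 3"
proof -
  show "even N" using p_odd by simp
  have "4 * 1 \<le> p * p * (p - 1)" using p3 by (intro mult_mono) (auto intro: order.trans[of 4 "p * 1"])
  then show "N > 3" by (simp add: power2_eq_square)
qed

lemma nat_unit: "0 < j \<Longrightarrow> j < p \<Longrightarrow> \<not> pdiv p 1 (of_nat j)"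
  using pdiv_of_nat_iff[OF p, of j] by (auto dest: dvd_imp_le)

text \<open>Each nonzero \<open>j ^ N\<close> is 1 modulo \<open>p^3\<close>, so the power sum is
  close to \<open>p - 1\<close>. The correction with \<open>k = 2\<close> could be too large, but
  its Bernoulli number has the odd index \<open>N - 1\<close> and vanishes.\<close>

lemma p_bernoulli_num_N: "pdiv p 2 (of_nat p * bernoulli_num N - (of_nat p - 1))"
proof -
  have "pdiv p 3 (\<Sum>j=1..<p. of_nat j ^ N - 1)"
    by (intro pdiv_sum euler_Zp[OF p] nat_unit) auto
  moreover have "(\<Sum>j<p. of_nat j ^ N) = (\<Sum>j=1..<p. of_nat j ^ N :: rat)"
    using N p3 by (simp add: lessThan_atLeast0 sum.atLeast_Suc_lessThan zero_power)
  moreover have "(\<Sum>j=1..<p. 1) = (of_nat p - 1 :: rat)" using p_pos by (simp add: of_nat_diff Suc_leI)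
  ultimately have "pdiv p 3 ((\<Sum>j<p. of_nat j ^ N) - (of_nat p - 1))"
    by (simp add: sum_subtractf)
  then have 1: "pdiv p 2 ((\<Sum>j<p. of_nat j ^ N) - (of_nat p - 1))" by (rule pdiv_mono) simp
  have "pdiv p 2 (\<Sum>k=2..Suc N. of_nat (N choose (k - 1)) * (bernoulli_num (Suc N - k) * (of_nat p ^ k / of_nat k)))"
  proof (intro pdiv_sum pdiv_scale[of p _ _ "of_nat _"] Zp_of_nat)
    fix k assume k: "k \<in> {2..Suc N}"
    show "pdiv p 2 (bernoulli_num (Suc N - k) * (of_nat p ^ k / of_nat k))"
    proof (cases "k = 2")
      case True
      have "bernoulli_num (N - 1) = 0" using N by (intro bernoulli_num_odd) auto
      then show ?thesis using True by simp
    next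
      case False
      then have "pdiv p (Suc 2) (of_nat p ^ k / of_nat k)" using k by (intro pdiv_power_p_div) auto
      then show ?thesis using p_bernoulli_num by (intro pdiv_mult_pole) auto
    qed
  qed
  then have 2: "pdiv p 2 ((\<Sum>j<p. of_nat j ^ N) - of_nat p * bernoulli_num N)"
    by (simp only: sum_powers_bernoulli) simp
  show ?thesis by (rule pdiv_trans[OF pdiv_sym[OF 2] 1])
qed

lemma power_minus_eq:
  assumes "(x :: rat) \<noteq> 0" "k \<le> n"
  shows "x ^ (n - k) - (1 / x) ^ k = (x ^ n - 1) * (1 / x) ^ k"
proof -
  have "x ^ n = x ^ (n - k) * x ^ k" using assms(2) by (simp flip: power_add)
  then show ?thesis using assms by (simp add: field_simps)
qed

text \<open>The pole is governed by the power sum of exponent \<open>N - 2\<close>, which is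
  congruent to the sum of inverse squares and hence divisible by \<open>p\<close>.\<close>

lemma bernoulli_num_N_minus_2: "bernoulli_num (N - 2) \<in> Zp p"
proof -
  have "pdiv p 1 (of_nat j ^ (N - 2) - 1 / (of_nat j)\<^sup>2)" if j: "j \<in> {1..<p}" for j
  proof -
    have "pdiv p 3 ((of_nat j ^ N - 1) * (1 / of_nat j)\<^sup>2)"
      using j by (intro pdiv_scale_right euler_Zp[OF p] nat_unit Zp_power Zp_inverse_less[OF p]) auto
    then have "pdiv p 3 (of_nat j ^ (N - 2) - 1 / (of_nat j)\<^sup>2)"
      using power_minus_eq[of "of_nat j" 2 N] j N by (simp add: power_one_over)
    then show ?thesis by (rule pdiv_mono) simp
  qed
  then have "pdiv p 1 (\<Sum>j=1..<p. of_nat j ^ (N - 2) - 1 / (of_nat j)\<^sup>2)" by (rule pdiv_sum)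
  then have "pdiv p 1 ((\<Sum>j=1..<p. of_nat j ^ (N - 2)) - (\<Sum>j=1..<p. 1 / (of_nat j)\<^sup>2))"
    by (simp only: sum_subtractf)
  from pdiv_add[OF this sum_inverse_squares[OF p p3]]
  have "pdiv p 1 (\<Sum>j=1..<p. of_nat j ^ (N - 2))" by simp
  moreover have "(\<Sum>j<p. of_nat j ^ (N - 2)) = (\<Sum>j=1..<p. of_nat j ^ (N - 2) :: rat)"
    using N p3 by (simp add: lessThan_atLeast0 sum.atLeast_Suc_lessThan zero_power)
  ultimately have "pdiv p 1 (\<Sum>j<p. of_nat j ^ (N - 2))" by simp
  then have "pdiv p 1 (of_nat p * bernoulli_num (N - 2) - (\<Sum>j<p. of_nat j ^ (N - 2)) + (\<Sum>j<p. of_nat j ^ (N - 2)))"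
    using p_bernoulli_num by (intro pdiv_add) auto
  then have "pdiv p (1 + 0) (of_nat p ^ 1 * bernoulli_num (N - 2))" by simp
  then show ?thesis using p_pos by (simp only: pdiv_cancel pdiv_0_iff)
qed

text \<open>In the expansion in powers of \<open>y\<close> the linear term vanishes by parity, the
  quadratic one has a p-integral Bernoulli number, and the later ones can afford a pole.\<close>

lemma T_quot_p_multiple:
  assumes y: "pdiv p 1 y"
  shows "pdiv p 2 (T_quot p y)"
proof -
  have my: "pdiv p 1 (- y)" using y by (simp add: pdiv_uminus_iff)
  have "T_quot p y = (\<Sum>k=1..N. of_nat ((N - 1) choose (k - 1)) * (bernoulli_num (N - k) * ((- y) ^ k / of_nat k)))"
    unfolding T_quot_def using N p3 by (subst bernoulli_poly_minus_bernoulli_num [symmetric]) auto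
  also have "pdiv p 2 \<dots>"
  proof (intro pdiv_sum pdiv_scale[of p _ _ "of_nat _"] Zp_of_nat)
    fix k assume k: "k \<in> {1..N}"
    consider "k = 1" | "k = 2" | "k \<ge> 3" using k by force
    then show "pdiv p 2 (bernoulli_num (N - k) * ((- y) ^ k / of_nat k))"
    proof cases
      case 1
      have "bernoulli_num (N - 1) = 0" using N by (intro bernoulli_num_odd) auto
      then show ?thesis using 1 by simp
    next
      case 2
      have "pdiv p 2 ((- y) ^ k / of_nat k)" using my 2 by (intro pdiv_power_div) auto
      then show ?thesis using bernoulli_num_N_minus_2 2 by (intro pdiv_scale) auto
    next
      case 3
      then have "pdiv p (Suc 2) ((- y) ^ k / of_nat k)" using my by (intro pdiv_power_div) auto
      then show ?thesis using p_bernoulli_num by (intro pdiv_mult_pole) auto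
    qed
  qed
  finally show ?thesis .
qed

text \<open>One step along the progression adds \<open>x ^ (N - 1)\<close> to \<open>T_quot\<close>,
  congruent to \<open>1 / x\<close>. Precision \<open>p^2\<close> is enough because
  \<open>T_quot\<close> enters the result with a factor \<open>p\<close>.\<close>

lemma T_quot_hsum:
  assumes y: "pdiv p 1 y" and "r < p"
  shows "pdiv p 2 (T_quot p (y + of_nat r) - hsum y r)"
  using assms(2)
proof (induction r)
  case 0
  then show ?case using T_quot_p_multiple[OF y] by (simp add: hsum_def)
next
  case (Suc r)
  define x where "x = y + of_nat (Suc r)"
  have x: "\<not> pdiv p 1 x" "1 / x \<in> Zp p" "x \<noteq> 0" "x \<in> Zp p"
    using shift_unit[OF p p3 y, of "Suc r"] Suc.prems pdiv_Zp[OF y] by (simp_all add: x_def del: of_nat_Suc)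
  have "odd (N - 1)" using N p3 by simp
  then have "(- x) ^ (N - 1) = - (x ^ (N - 1))" by simp
  then have "bernoulli_poly N (- x + 1) = bernoulli_poly N (- x) - of_nat N * x ^ (N - 1)"
    using bernoulli_poly_plus_1[of N "- x"] by simp
  moreover have "- x + 1 = - (y + of_nat r)" by (simp add: x_def)
  ultimately have "bernoulli_poly N (- x) = bernoulli_poly N (- (y + of_nat r)) + of_nat N * x ^ (N - 1)" by simp
  then have "T_quot p x = T_quot p (y + of_nat r) + x ^ (N - 1)"
    unfolding T_quot_def using N p3 by (simp add: add_divide_distrib diff_divide_distrib)
  moreover have "hsum y (Suc r) = hsum y r + 1 / x" by (simp add: hsum_def x_def)
  ultimately have e: "T_quot p x - hsum y (Suc r) = (T_quot p (y + of_nat r) - hsum y r) + (x ^ (N - 1) - (1 / x) ^ 1)"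
    by simp
  have "1 \<le> N" using N(2) by linarith
  have "pdiv p 3 (x ^ (N - 1) - (1 / x) ^ 1)"
    unfolding power_minus_eq[OF x(3) \<open>1 \<le> N\<close>]
    using x by (intro pdiv_scale_right euler_Zp[OF p]) auto
  then have "pdiv p 2 (x ^ (N - 1) - (1 / x) ^ 1)" by (rule pdiv_mono) simp
  then show ?case unfolding x_def [symmetric] e using Suc by (intro pdiv_add) simp_all
qed

lemma half_power_Zp: "1 / 2 ^ n \<in> Zp p"
  using Zp_power[OF half_Zp, of n] by (simp add: power_one_over)

lemma euler_poly_Zp: "x \<in> Zp p \<Longrightarrow> euler_poly n x \<in> Zp p"
proof -
  assume x: "x \<in> Zp p"
  have "(\<Sum>k=0..n. of_nat (n choose k) * (2*x - 1) ^ (n - k) * of_int (euler_num k)) * (1 / 2 ^ n) \<in> Zp p"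
    using x by (intro Zp_mult[OF _ half_power_Zp] Zp_sum Zp_mult Zp_power Zp_diff) auto
  then show ?thesis by (simp add: euler_poly_def)
qed

lemma euler_poly_cong:
  assumes "pdiv p m (x - y)" "x \<in> Zp p" "y \<in> Zp p"
  shows "pdiv p m (euler_poly n x - euler_poly n y)"
proof -
  have "euler_poly n x - euler_poly n y
      = (\<Sum>k=0..n. of_nat (n choose k) * ((2*x - 1) ^ (n - k) - (2*y - 1) ^ (n - k)) * of_int (euler_num k)) * (1 / 2 ^ n)"
    by (simp add: euler_poly_def diff_divide_distrib sum_subtractf right_diff_distrib left_diff_distrib)
  moreover have "pdiv p m ((2*x - 1) ^ k - (2*y - 1) ^ k)" for k
    using assms pdiv_scale[OF assms(1), of 2] by (intro pdiv_power_cong) (auto simp: algebra_simps)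
  then have "pdiv p m ((\<Sum>k=0..n. of_nat (n choose k) * ((2*x - 1) ^ (n - k) - (2*y - 1) ^ (n - k)) * of_int (euler_num k)) * (1 / 2 ^ n))"
    by (intro pdiv_scale_right[OF _ half_power_Zp] pdiv_sum pdiv_scale_right[OF _ Zp_of_int] pdiv_scale[OF _ Zp_of_nat])
  ultimately show ?thesis by simp
qed

text \<open>The difference equation adds \<open>2 * x ^ (p - 3)\<close>, congruent to
  \<open>2 / x^2\<close> by Fermat, with alternating sign. The start is the value at 0, which
  vanishes since \<open>p - 3\<close> is even and positive.\<close>

lemma euler_poly_qsum:
  assumes y: "pdiv p 1 y" and "r < p"
  shows "pdiv p 1 ((-1) ^ r * euler_poly (p - 3) (- (y + of_nat r)) - 2 * qsum y r)"
  using assms(2)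
proof (induction r)
  case 0
  have "pdiv p 1 (euler_poly (p - 3) (- y) - euler_poly (p - 3) 0)"
    using y pdiv_Zp[OF y] by (intro euler_poly_cong) (auto simp: pdiv_uminus_iff)
  moreover have "euler_poly (p - 3) 0 = 0" using p3 p_odd by (intro euler_poly_even_0) auto
  ultimately show ?case by (simp add: qsum_def)
next
  case (Suc r)
  define x where "x = y + of_nat (Suc r)"
  define s where "s = (-1 :: rat) ^ r"
  have x: "\<not> pdiv p 1 x" "1 / x \<in> Zp p" "x \<noteq> 0" "x \<in> Zp p"
    using shift_unit[OF p p3 y, of "Suc r"] Suc.prems pdiv_Zp[OF y] by (simp_all add: x_def del: of_nat_Suc)
  have "- x + 1 = - (y + of_nat r)" by (simp add: x_def)
  then have "euler_poly (p - 3) (- x) = 2 * (- x) ^ (p - 3) - euler_poly (p - 3) (- (y + of_nat r))"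
    using euler_poly_plus_1[of "p - 3" "- x"] by (metis add_diff_cancel_left')
  moreover have "(- x) ^ (p - 3) = x ^ (p - 3)" using p3 p_odd by (intro power_minus_even) auto
  moreover have "qsum y (Suc r) = qsum y r - s * (1 / x)\<^sup>2"
    by (simp add: qsum_def x_def s_def power_one_over)
  moreover have "(-1 :: rat) ^ Suc r = - s" by (simp add: s_def)
  ultimately have e: "(-1) ^ Suc r * euler_poly (p - 3) (- x) - 2 * qsum y (Suc r)
      = (s * euler_poly (p - 3) (- (y + of_nat r)) - 2 * qsum y r) - (2 * s) * (x ^ (p - 3) - (1 / x)\<^sup>2)"
    by (simp only:) (simp add: algebra_simps)
  have p2: "p - 1 - 2 = p - 3" by simp
  have "pdiv p 1 ((x ^ (p - 1) - 1) * (1 / x)\<^sup>2)"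
    using x by (intro pdiv_scale_right fermat_Zp[OF p]) auto
  then have "pdiv p 1 (x ^ (p - 3) - (1 / x)\<^sup>2)"
    using power_minus_eq[OF x(3), of 2 "p - 1"] p3 unfolding p2 by simp
  then have 1: "pdiv p 1 ((2 * s) * (x ^ (p - 3) - (1 / x)\<^sup>2))" by (rule pdiv_scale) (simp add: s_def)
  have 2: "pdiv p 1 (s * euler_poly (p - 3) (- (y + of_nat r)) - 2 * qsum y r)"
    using Suc by (simp add: s_def)
  show ?case unfolding x_def [symmetric] e by (rule pdiv_diff[OF 2 1])
qed

lemma G_cong:
  assumes x: "x \<in> Zp p" and t: "t = (x - of_nat (zp_res p x)) / of_nat p"
  shows "zp_cong p 3 (G (p - 1) x)
      ((-1) ^ zp_res p x * (1 - 2 * of_nat p * T_quot p x + 2 * of_nat p ^ 2 * T_quot p x ^ 2)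
       + of_nat p ^ 2 * (t * (t + 1) + 1) * euler_poly (p - 3) (-x))" (is "zp_cong p 3 _ ?R")
    and "t \<in> Zp p" "T_quot p x \<in> Zp p"
proof -
  define r y P where "r = zp_res p x" and "y = x - of_nat r" and "P = (of_nat p :: rat)"
  define s where "s = (-1 :: rat) ^ r"
  have r: "r < p" and y: "pdiv p 1 y" using zp_res[OF p x] by (simp_all add: r_def y_def)
  have xy: "y + of_nat r = x" by (simp add: y_def)
  have P0: "P \<noteq> 0" using p_pos by (simp add: P_def)
  have yt: "y = P * t" using P0 by (simp add: t y_def r_def P_def)
  have s: "s * s = 1" unfolding s_def by (simp add: power_add [symmetric])
  show Zt: "t \<in> Zp p"
    using pdiv_div[of p 0 1 y] y p_pos by (simp add: t y_def r_def pdiv_0_iff)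
  define H Q T E where "H = hsum y r" and "Q = qsum y r" and "T = T_quot p x" and "E = euler_poly (p - 3) (- x)"
  have H: "H \<in> Zp p" unfolding H_def by (rule hsum_Zp[OF p p3 y r])
  have TH: "pdiv p 2 (T - H)" using T_quot_hsum[OF y r] by (simp add: xy T_def H_def)
  show ZT: "T_quot p x \<in> Zp p" using Zp_add[OF pdiv_Zp[OF TH] H] by (simp add: T_def)
  have Z: "T \<in> Zp p" "E \<in> Zp p" "s \<in> Zp p" "P \<in> Zp p"
    using ZT x by (auto simp: T_def E_def s_def P_def euler_poly_Zp)
  have EQ: "pdiv p 1 (s * E - 2 * Q)"
    using euler_poly_qsum[OF y r] by (simp add: xy s_def E_def Q_def)
  have P1: "pdiv p 1 P" using pdiv_p_self by (simp add: P_def)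
  have P2: "pdiv p 2 (P\<^sup>2)" using pdiv_power[OF P1] .
  define A where "A = 1 - 2 * P * H + 2 * P\<^sup>2 * H\<^sup>2 + 2 * P\<^sup>2 * (t * (t + 1) + 1) * Q"
  define R where "R = s * (1 - 2 * P * T + 2 * P ^ 2 * T ^ 2) + P ^ 2 * (t * (t + 1) + 1) * E"
  \<comment> \<open>The factor \<open>x' * (x' + 1) + 1\<close> of the theorem appears here, from
    \<open>y = P * t\<close>.\<close>
  have yQ: "2 * (y\<^sup>2 + P * y + P\<^sup>2) * Q = 2 * P\<^sup>2 * (t * (t + 1) + 1) * Q"
    unfolding yt by (simp add: power2_eq_square algebra_simps)
  have GA: "pdiv p 3 (s * G (p - 1) x - A)"
    using G_mod_p3[OF p p3 y r] unfolding A_def yQ [symmetric]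
    by (simp only: xy s_def P_def H_def Q_def)
  \<comment> \<open>The errors of replacing \<open>H\<close> by \<open>T\<close> and
    \<open>2 * Q\<close> by \<open>s * E\<close> carry explicit factors \<open>P\<close> and
    \<open>P^2\<close>, so the available precisions \<open>p^2\<close> and \<open>p\<close>
    suffice.\<close>
  have "s * G (p - 1) x - s * R = (s * G (p - 1) x - A) + P * (T - H) * 2 - P\<^sup>2 * (T - H) * (2 * (T + H)) - P\<^sup>2 * (s * E - 2 * Q) * (t * (t + 1) + 1)"
  proof -
    have "s * R = (s * s) * (1 - 2 * P * T + 2 * P ^ 2 * T ^ 2) + s * P ^ 2 * (t * (t + 1) + 1) * E"
      by (simp add: R_def algebra_simps)
    then show ?thesis unfolding s A_def by (simp add: power2_eq_square algebra_simps)
  qed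
  also have "pdiv p 3 \<dots>"
  proof -
    have 1: "pdiv p 3 (P * (T - H))" using pdiv_mult[OF P1 TH] by (simp add: numeral_3_eq_3)
    have "pdiv p 4 (P\<^sup>2 * (T - H))" using pdiv_mult[OF P2 TH] by simp
    then have 2: "pdiv p 3 (P\<^sup>2 * (T - H))" by (rule pdiv_mono) simp
    have 3: "pdiv p 3 (P\<^sup>2 * (s * E - 2 * Q))" using pdiv_mult[OF P2 EQ] by simp
    have "2 * (T + H) \<in> Zp p" "t * (t + 1) + 1 \<in> Zp p" using Z H Zt by auto
    from pdiv_diff[OF pdiv_diff[OF pdiv_add[OF GA pdiv_scale_right[OF 1 Zp_numeral]]
        pdiv_scale_right[OF 2 this(1)]] pdiv_scale_right[OF 3 this(2)]]
    show ?thesis .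
  qed
  finally have "pdiv p 3 (s * (s * G (p - 1) x - s * R))" using Z(3) by (rule pdiv_scale)
  moreover have "s * (s * G (p - 1) x - s * R) = (s * s) * (G (p - 1) x - R)" by (simp add: algebra_simps)
  ultimately have "pdiv p 3 (G (p - 1) x - R)" using s by simp
  moreover have "R \<in> Zp p" unfolding R_def using Z Zt by (intro Zp_add Zp_mult Zp_diff Zp_power) auto
  ultimately have "zp_cong p 3 (G (p - 1) x) R" by (simp add: zp_cong_iff)
  then show "zp_cong p 3 (G (p - 1) x) ?R" by (simp only: R_def s_def r_def P_def T_def E_def)
qed

subsection \<open>Truncated exponentials and the values at -1/3, -1/4 and -1/6\<close>

text \<open>The truncated exponential is multiplicative up to multiples of \<open>L^2 * M\<close>
  and \<open>L * M^2\<close>, both divisible by \<open>p^3\<close>.\<close>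

lemma exp_cong_mult:
  assumes "exp_cong p L A" "exp_cong p M B"
  shows "exp_cong p (L + M) (A * B)"
proof -
  define K where "K = 1 + M + M\<^sup>2 / 2"
  have L: "pdiv p 1 L" "pdiv p 3 (1 + L + L\<^sup>2 / 2 - A)"
    and M: "pdiv p 1 M" "pdiv p 3 (K - B)" using assms(1,2) by (simp_all add: exp_cong_def K_def)
  have Z: "L \<in> Zp p" "M \<in> Zp p" "1 / 2 \<in> Zp p"
    using L(1) M(1) pdiv_Zp half_Zp by auto
  have ZK: "K \<in> Zp p"
  proof -
    have "1 + M + M\<^sup>2 * (1 / 2) \<in> Zp p" using Z(2,3) by (intro Zp_add Zp_mult Zp_power) auto
    then show ?thesis by (simp add: K_def)
  qed
  have ZA: "A \<in> Zp p"
  proof -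
    have "1 + L + L\<^sup>2 * (1 / 2) \<in> Zp p" using Z by (intro Zp_add Zp_mult Zp_power) auto
    from Zp_diff[OF this pdiv_Zp[OF L(2)]] show ?thesis by simp
  qed
  have 1: "pdiv p 3 ((1 + L + L\<^sup>2 / 2) * K - A * B)"
    using L(2) M(2) ZK ZA by (rule pdiv_mult_cong)
  have 2: "pdiv p 3 (L\<^sup>2 * M)" "pdiv p 3 (L * M\<^sup>2)"
    using pdiv_mult[OF pdiv_power[OF L(1), of 2] M(1)] pdiv_mult[OF L(1) pdiv_power[OF M(1), of 2]]
    by (simp_all add: numeral_3_eq_3)
  have 3: "pdiv p 3 (L\<^sup>2 * M * ((1 / 2) * (1 + M * (1 / 2))) + L * M\<^sup>2 * (1 / 2))"
    using Z by (intro pdiv_add pdiv_scale_right[OF 2(1)] pdiv_scale_right[OF 2(2)] Zp_mult Zp_add) auto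
  have e: "(1 + L + L\<^sup>2 / 2) * K - A * B - (L\<^sup>2 * M * ((1 / 2) * (1 + M * (1 / 2))) + L * M\<^sup>2 * (1 / 2))
      = 1 + (L + M) + (L + M)\<^sup>2 / 2 - A * B"
    unfolding K_def by (simp add: power2_eq_square field_simps)
  from pdiv_diff[OF 1 3] have "pdiv p 3 (1 + (L + M) + (L + M)\<^sup>2 / 2 - A * B)" unfolding e .
  then show ?thesis using pdiv_add[OF L(1) M(1)] by (simp add: exp_cong_def)
qed

lemma exp_cong_power:
  assumes "exp_cong p L A"
  shows "exp_cong p (of_nat k * L) (A ^ k)"
proof (induction k)
  case (Suc k)
  then show ?case using exp_cong_mult[OF assms(1) Suc] by (simp add: algebra_simps)
qed (simp add: exp_cong_def)

lemma exp_cong_trans: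
  assumes "exp_cong p L A" "pdiv p 3 (L' - L)"
  shows "exp_cong p L' A"
proof -
  have "exp_cong p (L' - L) 1"
  proof -
    have e: "1 + (L' - L) + (L' - L)\<^sup>2 / 2 - 1 = (L' - L) * (1 + (L' - L) * (1 / 2))"
      by (simp add: power2_eq_square field_simps)
    have "1 + (L' - L) * (1 / 2) \<in> Zp p"
      by (intro Zp_add Zp_mult pdiv_Zp[OF assms(2)] half_Zp) simp
    from pdiv_scale_right[OF assms(2) this] pdiv_mono[OF assms(2), of 1]
    show ?thesis unfolding exp_cong_def e by simp
  qed
  from exp_cong_mult[OF assms(1) this] show ?thesis by simp
qed

text \<open>The bracket is \<open>log (1 + v)\<close> to second order. Writing
  \<open>M choose k\<close> as \<open>M / k * ((M - 1) choose (k - 1))\<close> with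
  \<open>M = p^2\<close>, the terms from \<open>k = 3\<close> on are divisible by
  \<open>p^2 * p^3\<close>; in the quadratic term \<open>M - 1\<close> is replaced by -1 at the cost
  of a multiple of \<open>p^6\<close>.\<close>

lemma power_p2_expansion:
  assumes v: "pdiv p 1 v"
  shows "pdiv p 5 ((1 + v) ^ p\<^sup>2 - 1 - (of_nat p)\<^sup>2 * (v - v\<^sup>2 / 2))"
proof -
  define M where "M = p\<^sup>2"
  have M: "M \<ge> 2" "M > 0" using p3 power_increasing[of 1 2 p] unfolding M_def by auto
  have Zv: "v \<in> Zp p" using v by (rule pdiv_Zp)
  have p2: "pdiv p 2 (of_nat M)" using pdivI[of 1 p 2] by (simp add: M_def)
  have "(1 + v) ^ M = (\<Sum>k=0..M. of_nat (M choose k) * v ^ k)"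
    using binomial_ring[of v 1 M] by (simp add: add.commute atLeast0AtMost)
  also have "\<dots> = 1 + (\<Sum>k=1..M. of_nat (M choose k) * v ^ k)"
    by (simp add: sum.atLeast_Suc_atMost)
  also have "(\<Sum>k=1..M. of_nat (M choose k) * v ^ k) = (\<Sum>k=1..M. of_nat M * (of_nat ((M - 1) choose (k - 1)) * (v ^ k / of_nat k)))"
  proof (rule sum.cong[OF refl])
    fix k assume "k \<in> {1..M}"
    then obtain j where j: "k = Suc j" by (cases k) auto
    have "of_nat (Suc j) * of_nat (M choose Suc j) = (of_nat M * of_nat ((M - 1) choose j) :: rat)"
      by (metis binomial_absorption of_nat_mult)
    then have "of_nat (M choose Suc j) = (of_nat M * of_nat ((M - 1) choose j) / of_nat (Suc j) :: rat)"
      by (simp add: field_simps del: of_nat_Suc)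
    then show "of_nat (M choose k) * v ^ k = of_nat M * (of_nat ((M - 1) choose (k - 1)) * (v ^ k / of_nat k))"
      by (simp add: j del: of_nat_Suc)
  qed
  also have "\<dots> = of_nat M * v + (of_nat M * ((of_nat M - 1) * (v\<^sup>2 / 2))
      + of_nat M * (\<Sum>k=3..M. of_nat ((M - 1) choose (k - 1)) * (v ^ k / of_nat k)))"
  proof -
    have "of_nat (M - 1) = (of_nat M - 1 :: rat)" using M by (simp add: of_nat_diff)
    then show ?thesis using M
      by (subst sum.atLeast_Suc_atMost, simp, subst sum.atLeast_Suc_atMost)
        (simp_all add: numeral_2_eq_2 numeral_3_eq_3 sum_distrib_left)
  qed
  finally have expand: "(1 + v) ^ M = 1 + (of_nat M * v + (of_nat M * ((of_nat M - 1) * (v\<^sup>2 / 2))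
      + of_nat M * (\<Sum>k=3..M. of_nat ((M - 1) choose (k - 1)) * (v ^ k / of_nat k))))" .
  define h where "h = v\<^sup>2 / 2"
  have h: "v\<^sup>2 = 2 * h" by (simp add: h_def)
  have "(1 + v) ^ M - 1 - of_nat M * (v - v\<^sup>2 / 2)
      = of_nat M * (of_nat M * v\<^sup>2 * (1 / 2)) + of_nat M * (\<Sum>k=3..M. of_nat ((M - 1) choose (k - 1)) * (v ^ k / of_nat k))"
    unfolding expand h by (simp add: algebra_simps)
  also have "pdiv p 5 \<dots>"
  proof (rule pdiv_add)
    have "pdiv p 4 (of_nat M * v\<^sup>2)" using pdiv_mult[OF p2 pdiv_power[OF v, of 2]] by simp
    from pdiv_mult[OF p2 pdiv_scale_right[OF this half_Zp]]
    have "pdiv p 6 (of_nat M * (of_nat M * v\<^sup>2 * (1 / 2)))" by simp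
    then show "pdiv p 5 (of_nat M * (of_nat M * v\<^sup>2 * (1 / 2)))" by (rule pdiv_mono) simp
    have "pdiv p 3 (\<Sum>k=3..M. of_nat ((M - 1) choose (k - 1)) * (v ^ k / of_nat k))"
      using v by (intro pdiv_sum pdiv_scale[OF _ Zp_of_nat] pdiv_power_div) auto
    from pdiv_mult[OF p2 this]
    show "pdiv p 5 (of_nat M * (\<Sum>k=3..M. of_nat ((M - 1) choose (k - 1)) * (v ^ k / of_nat k)))" by simp
  qed
  finally show ?thesis by (simp add: M_def)
qed

lemma nat_inverse_unit:
  assumes "\<not> p dvd a"
  shows "1 / of_nat a \<in> Zp p" "\<not> pdiv p 1 (1 / of_nat a)"
proof -
  show "1 / of_nat a \<in> Zp p" using assms by (rule Zp_inverse_of_nat[OF p])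
  have a: "a \<noteq> 0" using assms by (intro notI) simp
  show "\<not> pdiv p 1 (1 / of_nat a)"
  proof
    assume "pdiv p 1 (1 / of_nat a)"
    then have "pdiv p 1 (of_nat a * (1 / of_nat a))" by (rule pdiv_scale) simp
    then have "pdiv p 1 (of_nat 1)" using a by simp
    then show False unfolding pdiv_of_nat_iff[OF p] using p3 by simp
  qed
qed

lemma pdiv_dev: "\<not> p dvd a \<Longrightarrow> pdiv p 3 (dev p a)"
  unfolding dev_def using pdiv_sym[OF euler_Zp[OF p nat_inverse_unit]] .

text \<open>Additivity of the logarithm: the defect is the product of two deviations, each divisible
  by \<open>p^3\<close>.\<close>

lemma dev_mult:
  assumes "\<not> p dvd a" "\<not> p dvd b"
  shows "pdiv p 6 (dev p (a * b) - (dev p a + dev p b))"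
proof -
  have "dev p (a * b) - (dev p a + dev p b) = - (dev p a * dev p b)"
    by (simp add: dev_def power_mult_distrib power_divide algebra_simps)
  then show ?thesis using pdiv_mult[OF pdiv_dev[OF assms(1)] pdiv_dev[OF assms(2)]]
    by (simp add: pdiv_uminus_iff)
qed

lemma exp_cong_dev:
  assumes "\<not> p dvd a"
  shows "exp_cong p (dev p a / (of_nat p)\<^sup>2) (of_nat a ^ (p - 1))"
proof -
  define w v where "w = (of_nat a ^ (p - 1) :: rat)" and "v = (1 / of_nat a) ^ (p - 1) - (1 :: rat)"
  have a: "a \<noteq> 0" using assms by (intro notI) simp
  have w: "w * (1 + v) = 1" using a by (simp add: w_def v_def power_one_over)
  have v: "pdiv p 1 v" unfolding v_def by (rule fermat_Zp[OF p nat_inverse_unit[OF assms]])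
  have Z: "w \<in> Zp p" "v \<in> Zp p" using pdiv_Zp[OF v] by (simp_all add: w_def)
  \<comment> \<open>As \<open>1 + v\<close> is the inverse of \<open>w\<close>, the logarithm of
    \<open>w\<close> is \<open>- log (1 + v)\<close>, here to second order. The inverse is taken
    because \<open>dev\<close> is built from \<open>1 / a\<close>.\<close>
  define L where "L = - v + v\<^sup>2 * (1 / 2)"
  have half: "1 / 2 \<in> Zp p" by (rule half_Zp)
  have "pdiv p 1 (v * (- 1 + v * (1 / 2)))" using Z half by (intro pdiv_scale_right[OF v] Zp_add Zp_mult) auto
  then have L1: "pdiv p 1 L" by (simp add: L_def power2_eq_square algebra_simps)
  have "1 + L + L\<^sup>2 / 2 - w = v ^ 3 * (w - 1 / 2 + v * (1 / 2) ^ 3)"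
  proof -
    have "w * v ^ 3 = (w * (1 + v)) * (1 - v + v\<^sup>2) - w" by (simp add: power2_eq_square power3_eq_cube algebra_simps)
    then have "w * v ^ 3 = 1 - v + v\<^sup>2 - w" unfolding w by simp
    then show ?thesis by (simp add: L_def power2_eq_square power3_eq_cube field_simps)
  qed
  moreover have "pdiv p 3 (v ^ 3 * (w - 1 / 2 + v * (1 / 2) ^ 3))"
    using Z half by (intro pdiv_scale_right pdiv_power[OF v] Zp_add Zp_diff Zp_mult Zp_power) auto
  ultimately have "exp_cong p L w" using L1 by (simp add: exp_cong_def)
  moreover have "pdiv p 3 (dev p a / (of_nat p)\<^sup>2 - L)"
  proof -
    have "(1 + v) ^ p\<^sup>2 = (1 / of_nat a) ^ N" by (simp add: v_def mult.commute flip: power_mult)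
    then have e: "dev p a - (of_nat p)\<^sup>2 * L = - ((1 + v) ^ p\<^sup>2 - 1 - (of_nat p)\<^sup>2 * (v - v\<^sup>2 / 2))"
      by (simp add: dev_def L_def algebra_simps)
    have "pdiv p 5 (dev p a - (of_nat p)\<^sup>2 * L)"
      unfolding e pdiv_uminus_iff by (rule power_p2_expansion[OF v])
    then have "pdiv p (3 + 2) (dev p a - (of_nat p)\<^sup>2 * L)" by simp
    from pdiv_div[OF p_pos this] show ?thesis using p3 by (simp add: diff_divide_distrib)
  qed
  ultimately show ?thesis unfolding w_def using exp_cong_trans by blast
qed

text \<open>By \<open>B\<close>, \<open>- 2 * p * T_quot p x\<close> is \<open>D / p^2\<close> times
  \<open>p * bernoulli_num N / (p - 1)\<close>. The latter is 1 modulo \<open>p^2\<close> and the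
  former is divisible by \<open>p\<close>, so the product is \<open>D / p^2\<close> modulo
  \<open>p^3\<close>; dividing by \<open>p^2\<close> is why \<open>L\<close> must match
  \<open>D\<close> modulo \<open>p^5\<close>.\<close>

lemma exp_cong_T_quot:
  assumes B: "2 * (bernoulli_poly N (- x) - bernoulli_num N) = - (bernoulli_num N * D)"
    and D: "pdiv p 3 D" and L: "pdiv p 5 (D - (of_nat p)\<^sup>2 * L)" and A: "exp_cong p L A"
  shows "exp_cong p (- 2 * of_nat p * T_quot p x) A"
proof (rule exp_cong_trans[OF A])
  define P where "P = (of_nat p :: rat)"
  have P: "P \<noteq> 0" "P - 1 \<noteq> 0" "of_nat (p - 1) = P - 1" using p3 by (auto simp: P_def of_nat_diff)
  have inv: "1 / (P - 1) \<in> Zp p" using Zp_inverse_less[OF p, of "p - 1"] p3 P(3) by simp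
  have "- 2 * P * (b / Q) = - P * (2 * b) / Q" for b Q :: rat by simp
  then have "- 2 * P * T_quot p x = - P * (2 * (bernoulli_poly N (- x) - bernoulli_num N)) / (P\<^sup>2 * (P - 1))"
    by (simp only: T_quot_def of_nat_mult of_nat_power P(3) P_def [symmetric])
  also have "\<dots> = P * bernoulli_num N * (D / P\<^sup>2) * (1 / (P - 1))" unfolding B by simp
  finally have T: "- 2 * P * T_quot p x = P * bernoulli_num N * (D / P\<^sup>2) * (1 / (P - 1))" .
  define d q where "d = D / P\<^sup>2" and "q = 1 / (P - 1)"
  have dq: "(D - P\<^sup>2 * L) / P\<^sup>2 = d - L" "(P - 1) * q = 1"
    using P by (simp_all add: d_def q_def diff_divide_distrib)
  have "(P * bernoulli_num N - (P - 1)) * d * q = P * bernoulli_num N * d * q - ((P - 1) * q) * d"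
    by (simp add: algebra_simps)
  then have "- 2 * P * T_quot p x - L
      = (P * bernoulli_num N - (P - 1)) * (D / P\<^sup>2) * (1 / (P - 1)) + (D - P\<^sup>2 * L) / P\<^sup>2"
    unfolding T dq d_def [symmetric] q_def [symmetric] by simp
  also have "pdiv p 3 \<dots>"
  proof (rule pdiv_add)
    have "pdiv p 1 (D / P\<^sup>2)" using pdiv_div[OF p_pos, of 1 2 D] D by (simp add: P_def numeral_3_eq_3)
    from pdiv_scale_right[OF pdiv_mult[OF p_bernoulli_num_N this] inv]
    show "pdiv p 3 ((P * bernoulli_num N - (P - 1)) * (D / P\<^sup>2) * (1 / (P - 1)))" by (simp add: P_def)
    show "pdiv p 3 ((D - P\<^sup>2 * L) / P\<^sup>2)"
      using pdiv_div[OF p_pos, of 3 2] L by (simp add: P_def)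
  qed
  finally show "pdiv p 3 (- 2 * of_nat p * T_quot p x - L)" by (simp add: P_def)
qed

text \<open>The multiplication theorem, with the values at 1/3 and 2/3 identified by reflection for
  even \<open>N\<close>. The right side has the shape that \<open>exp_cong_T_quot\<close>
  expects.\<close>

lemma bernoulli_poly_third:
  "2 * (bernoulli_poly N (1/3) - bernoulli_num N) = - (bernoulli_num N * (3 * dev p 3))"
proof -
  have "3 ^ N * (bernoulli_num N + bernoulli_poly N (1/3) + bernoulli_poly N (2/3)) = 3 * bernoulli_num N"
    using bernoulli_poly_multiplication[of 3 N] by (simp add: numeral_3_eq_3 bernoulli_poly_0)
  moreover have "bernoulli_poly N (2/3) = bernoulli_poly N (1/3)"
    using bernoulli_poly_reflect[of N "1/3"] N(1) by simp
  ultimately have "2 * bernoulli_poly N (1/3) = 3 * bernoulli_num N / 3 ^ N - bernoulli_num N"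
    by (simp add: field_simps)
  then show ?thesis by (simp add: dev_def power_one_over algebra_simps)
qed

text \<open>Needed for the arguments 2/4 and 3/6 in the multiplication theorem for 4 and 6.\<close>

lemma bernoulli_poly_half:
  "2 * (bernoulli_poly N (1/2) - bernoulli_num N) = - (bernoulli_num N * (4 * dev p 2))"
proof -
  have "2 ^ N * (bernoulli_num N + bernoulli_poly N (1/2)) = 2 * bernoulli_num N"
    using bernoulli_poly_multiplication[of 2 N] by (simp add: numeral_2_eq_2 bernoulli_poly_0)
  then have "bernoulli_poly N (1/2) = 2 * bernoulli_num N / 2 ^ N - bernoulli_num N"
    by (simp add: field_simps)
  then show ?thesis by (simp add: dev_def power_one_over algebra_simps)
qed

lemma bernoulli_poly_quarter:
  "2 * (bernoulli_poly N (1/4) - bernoulli_num N) = - (bernoulli_num N * (4 * dev p 4 - 2 * dev p 2))"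
proof -
  have "4 ^ N * (bernoulli_num N + bernoulli_poly N (1/4) + bernoulli_poly N (2/4) + bernoulli_poly N (3/4)) = 4 * bernoulli_num N"
    using bernoulli_poly_multiplication[of 4 N] by (simp add: eval_nat_numeral bernoulli_poly_0)
  moreover have "bernoulli_poly N (3/4) = bernoulli_poly N (1/4)"
    using bernoulli_poly_reflect[of N "1/4"] N(1) by simp
  ultimately have "2 * bernoulli_poly N (1/4) = 4 * bernoulli_num N / 4 ^ N - bernoulli_num N - bernoulli_poly N (1/2)"
    by (simp add: field_simps)
  then show ?thesis using bernoulli_poly_half by (simp add: dev_def power_one_over algebra_simps)
qed

lemma bernoulli_poly_sixth:
  "2 * (bernoulli_poly N (1/6) - bernoulli_num N)
     = - (bernoulli_num N * (6 * dev p 6 - 2 * dev p 2 - 3 * dev p 3))"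
proof -
  have "6 ^ N * (bernoulli_num N + bernoulli_poly N (1/6) + bernoulli_poly N (2/6) + bernoulli_poly N (3/6)
      + bernoulli_poly N (4/6) + bernoulli_poly N (5/6)) = 6 * bernoulli_num N"
    using bernoulli_poly_multiplication[of 6 N] by (simp add: eval_nat_numeral bernoulli_poly_0)
  moreover have "bernoulli_poly N (5/6) = bernoulli_poly N (1/6)" "bernoulli_poly N (2/3) = bernoulli_poly N (1/3)"
    using bernoulli_poly_reflect[of N "1/6"] bernoulli_poly_reflect[of N "1/3"] N(1) by simp_all
  ultimately have "2 * bernoulli_poly N (1/6) = 6 * bernoulli_num N / 6 ^ N - bernoulli_num N - bernoulli_poly N (1/2) - 2 * bernoulli_poly N (1/3)"
    by (simp add: field_simps)
  then show ?thesis using bernoulli_poly_half bernoulli_poly_third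
    by (simp add: dev_def power_one_over algebra_simps)
qed

lemma not_dvd_2_3:
  shows "\<not> p dvd 2" "\<not> p dvd 3"
  using p3 by (auto dest: dvd_imp_le)

lemma T_quot_exp_third:
  "exp_cong p (- 2 * of_nat p * T_quot p (-1/3)) (27 ^ (p - 1))"
proof -
  have A: "exp_cong p (of_nat 3 * (dev p 3 / (of_nat p)\<^sup>2)) ((of_nat 3 ^ (p - 1)) ^ 3)"
    by (intro exp_cong_power exp_cong_dev not_dvd_2_3)
  have "exp_cong p (- 2 * of_nat p * T_quot p (-1/3)) ((of_nat 3 ^ (p - 1)) ^ 3)"
    using bernoulli_poly_third pdiv_dev[OF not_dvd_2_3(2)] p3
    by (intro exp_cong_T_quot[OF _ _ _ A, of _ "3 * dev p 3"]) (auto intro: pdiv_scale)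
  moreover have "(of_nat 3 ^ (p - 1)) ^ 3 = (27 :: rat) ^ (p - 1)"
    by (simp add: power_mult [symmetric] mult.commute[of _ 3]) (simp add: power_mult)
  ultimately show ?thesis by simp
qed

text \<open>Since \<open>dev p 4\<close> is nearly \<open>2 * dev p 2\<close>, the combination
  \<open>4 * dev p 4 - 2 * dev p 2\<close> is nearly \<open>6 * dev p 2\<close>, and
  \<open>64 = 2^6\<close>.\<close>

lemma T_quot_exp_quarter:
  "exp_cong p (- 2 * of_nat p * T_quot p (-1/4)) (64 ^ (p - 1))"
proof -
  have A: "exp_cong p (of_nat 6 * (dev p 2 / (of_nat p)\<^sup>2)) ((of_nat 2 ^ (p - 1)) ^ 6)"
    by (intro exp_cong_power exp_cong_dev not_dvd_2_3)
  have d2: "pdiv p 3 (dev p 2)" by (intro pdiv_dev not_dvd_2_3)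
  have "pdiv p 6 (dev p 4 - 2 * dev p 2)"
    using dev_mult[OF not_dvd_2_3(1) not_dvd_2_3(1)] by simp
  then have d4: "pdiv p 6 (4 * (dev p 4 - 2 * dev p 2))" by (rule pdiv_scale) simp
  have e: "4 * dev p 4 - 2 * dev p 2 = 4 * (dev p 4 - 2 * dev p 2) + 6 * dev p 2"
    "(of_nat p)\<^sup>2 * (of_nat 6 * (dev p 2 / (of_nat p)\<^sup>2)) = 6 * dev p 2"
    using p3 by simp_all
  have "exp_cong p (- 2 * of_nat p * T_quot p (-1/4)) ((of_nat 2 ^ (p - 1)) ^ 6)"
  proof (rule exp_cong_T_quot[OF _ _ _ A])
    show "2 * (bernoulli_poly N (- (-1/4)) - bernoulli_num N) = - (bernoulli_num N * (4 * dev p 4 - 2 * dev p 2))"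
      using bernoulli_poly_quarter by simp
    have "pdiv p 3 (4 * (dev p 4 - 2 * dev p 2))" using d4 by (rule pdiv_mono) simp
    then show "pdiv p 3 (4 * dev p 4 - 2 * dev p 2)"
      unfolding e by (rule pdiv_add) (rule pdiv_scale[OF d2], simp)
    have "pdiv p 5 (4 * (dev p 4 - 2 * dev p 2))" using d4 by (rule pdiv_mono) simp
    then show "pdiv p 5 (4 * dev p 4 - 2 * dev p 2 - (of_nat p)\<^sup>2 * (of_nat 6 * (dev p 2 / (of_nat p)\<^sup>2)))"
      unfolding e by (simp only: add_diff_cancel_right')
  qed
  moreover have "(of_nat 2 ^ (p - 1)) ^ 6 = (64 :: rat) ^ (p - 1)"
    by (simp add: power_mult [symmetric] mult.commute[of _ 6]) (simp add: power_mult)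
  ultimately show ?thesis by simp
qed

text \<open>Splitting \<open>dev p 6\<close> into \<open>dev p 2 + dev p 3\<close> leaves the
  coefficients 4 and 3, and \<open>432 = 2^4 * 3^3\<close>.\<close>

lemma T_quot_exp_sixth:
  "exp_cong p (- 2 * of_nat p * T_quot p (-1/6)) (432 ^ (p - 1))"
proof -
  have A: "exp_cong p (of_nat 4 * (dev p 2 / (of_nat p)\<^sup>2) + of_nat 3 * (dev p 3 / (of_nat p)\<^sup>2))
      ((of_nat 2 ^ (p - 1)) ^ 4 * (of_nat 3 ^ (p - 1)) ^ 3)"
    by (intro exp_cong_mult exp_cong_power exp_cong_dev not_dvd_2_3)
  have d2: "pdiv p 3 (dev p 2)" and d3: "pdiv p 3 (dev p 3)" by (intro pdiv_dev not_dvd_2_3)+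
  have "pdiv p 6 (dev p 6 - (dev p 2 + dev p 3))"
    using dev_mult[OF not_dvd_2_3(1) not_dvd_2_3(2)] by simp
  then have d6: "pdiv p 6 (6 * (dev p 6 - (dev p 2 + dev p 3)))" by (rule pdiv_scale) simp
  have e: "6 * dev p 6 - 2 * dev p 2 - 3 * dev p 3 = 6 * (dev p 6 - (dev p 2 + dev p 3)) + (4 * dev p 2 + 3 * dev p 3)"
    "(of_nat p)\<^sup>2 * (of_nat 4 * (dev p 2 / (of_nat p)\<^sup>2) + of_nat 3 * (dev p 3 / (of_nat p)\<^sup>2)) = 4 * dev p 2 + 3 * dev p 3"
    using p3 by (simp_all add: distrib_left)
  have "exp_cong p (- 2 * of_nat p * T_quot p (-1/6)) ((of_nat 2 ^ (p - 1)) ^ 4 * (of_nat 3 ^ (p - 1)) ^ 3)"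
  proof (rule exp_cong_T_quot[OF _ _ _ A])
    show "2 * (bernoulli_poly N (- (-1/6)) - bernoulli_num N) = - (bernoulli_num N * (6 * dev p 6 - 2 * dev p 2 - 3 * dev p 3))"
      using bernoulli_poly_sixth by simp
    have "pdiv p 3 (6 * (dev p 6 - (dev p 2 + dev p 3)))" using d6 by (rule pdiv_mono) simp
    then show "pdiv p 3 (6 * dev p 6 - 2 * dev p 2 - 3 * dev p 3)"
      unfolding e by (rule pdiv_add[OF _ pdiv_add[OF pdiv_scale[OF d2] pdiv_scale[OF d3]]]) simp_all
    have "pdiv p 5 (6 * (dev p 6 - (dev p 2 + dev p 3)))" using d6 by (rule pdiv_mono) simp
    then show "pdiv p 5 (6 * dev p 6 - 2 * dev p 2 - 3 * dev p 3
        - (of_nat p)\<^sup>2 * (of_nat 4 * (dev p 2 / (of_nat p)\<^sup>2) + of_nat 3 * (dev p 3 / (of_nat p)\<^sup>2)))"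
      unfolding e by (simp only: add_diff_cancel_right')
  qed
  moreover have "(of_nat 2 ^ (p - 1)) ^ 4 * (of_nat 3 ^ (p - 1)) ^ 3 = (432 :: rat) ^ (p - 1)"
  proof -
    have "((of_nat 2 :: rat) ^ (p - 1)) ^ 4 = 16 ^ (p - 1)" "((of_nat 3 :: rat) ^ (p - 1)) ^ 3 = 27 ^ (p - 1)"
      by (simp_all add: power_mult [symmetric] mult.commute[of "p - Suc 0"]) (simp_all add: power_mult)
    then show ?thesis by (simp flip: power_mult_distrib)
  qed
  ultimately show ?thesis by simp
qed

text \<open>Here \<open>m * r + 1 = p * j\<close> encodes \<open>r\<close> as the residue of \<open>x = -1/m\<close>, with \<open>x' = -j/m\<close>.\<close>

lemma scaled_G_cong:
  fixes m r j c :: nat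
  assumes m: "m > 0" "\<not> p dvd m" and r: "m * r + 1 = p * j" "j < m"
    and A: "exp_cong p (- 2 * of_nat p * T_quot p (-1 / of_nat m)) (of_nat c ^ (p - 1))" and c: "\<not> p dvd c"
    and V: "V \<in> Zp p" "pdiv p 1 ((1 - of_nat j * (of_nat m - of_nat j) / (of_nat m)\<^sup>2) * euler_poly (p - 3) (1 / of_nat m) - V)"
    and sg: "even r \<longleftrightarrow> even r'"
  shows "zp_cong p 3 (of_nat c ^ (p - 1) * G (p - 1) (-1 / of_nat m))
    ((-1) ^ r' * (of_nat c ^ (p - 1))\<^sup>2 + (of_nat p)\<^sup>2 * V)"
proof -
  define x P where "x = (-1 / of_nat m :: rat)" and "P = (of_nat p :: rat)"
  have m0: "of_nat m \<noteq> (0 :: rat)" and P0: "P \<noteq> 0" using m p3 by (auto simp: P_def)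
  have Zm: "1 / of_nat m \<in> Zp p" using m by (intro Zp_inverse_of_nat[OF p])
  have Zx: "x \<in> Zp p" using Zm by (simp add: x_def)
  have rr: "(of_nat m * of_nat r + 1 :: rat) = P * of_nat j"
    using arg_cong[OF r(1), of "of_nat :: nat \<Rightarrow> rat"] by (simp add: P_def)
  have xr: "x - of_nat r = P * (- of_nat j / of_nat m)"
  proof -
    have "P * (- of_nat j / of_nat m) = - (of_nat m * of_nat r + 1) / of_nat m" unfolding rr by simp
    moreover have "x - of_nat r = - (of_nat m * of_nat r + 1) / of_nat m"
      using m0 by (simp add: x_def field_simps)
    ultimately show ?thesis by (simp only:)
  qed
  have "m * r < m * p"
  proof -
    have "p * j \<le> m * p" using r(2) by (subst mult.commute) (rule mult_le_mono1, simp)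
    then show ?thesis using r(1) by linarith
  qed
  then have "r < p" by simp
  moreover have "- of_nat j / of_nat m \<in> Zp p" using Zp_mult[OF _ Zm, of "- of_nat j"] by simp
  then have "pdiv p 1 (x - of_nat r)" unfolding xr P_def by (rule pdiv_p)
  ultimately have res: "zp_res p x = r" by (rule zp_res_eqI[OF p])
  define t where "t = - of_nat j / (of_nat m :: rat)"
  have t: "t = (x - of_nat (zp_res p x)) / of_nat p"
    unfolding res xr t_def using P0 by (simp add: P_def)
  define s L W C where "s = (-1 :: rat) ^ r" and "L = - 2 * P * T_quot p x"
    and "W = (t * (t + 1) + 1) * euler_poly (p - 3) (- x)" and "C = (of_nat c ^ (p - 1) :: rat)"
  have "zp_cong p 3 (G (p - 1) x) (s * (1 + L + L\<^sup>2 / 2) + P\<^sup>2 * W)"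
    using G_cong(1)[OF Zx t] unfolding res L_def P_def W_def s_def
    by (simp add: power2_eq_square mult.assoc)
  then have 1: "pdiv p 3 (G (p - 1) x - (s * (1 + L + L\<^sup>2 / 2) + P\<^sup>2 * W))" by (simp add: zp_cong_iff)
  have 2: "pdiv p 3 (1 + L + L\<^sup>2 / 2 - C)" using A by (simp add: exp_cong_def L_def C_def x_def P_def)
  have ZW: "W \<in> Zp p" unfolding W_def using Zx G_cong(2)[OF Zx t]
    by (intro Zp_mult Zp_add euler_poly_Zp) auto
  have Z: "C \<in> Zp p" "s \<in> Zp p" "P \<in> Zp p" by (simp_all add: C_def s_def P_def)
  \<comment> \<open>In the term with \<open>P^2\<close> the scaling factor matters only modulo
    \<open>p\<close>, where it is 1. In the main term it meets an exponential congruent to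
    \<open>C\<close> itself, which produces the square.\<close>
  have C1: "pdiv p 1 (C - 1)" unfolding C_def
    using c by (intro fermat_Zp[OF p]) (simp_all only: pdiv_of_nat_iff[OF p] Zp_of_nat not_False_eq_True)
  have "W = (1 - of_nat j * (of_nat m - of_nat j) / (of_nat m)\<^sup>2) * euler_poly (p - 3) (1 / of_nat m)"
    unfolding W_def t_def x_def using m0 by (simp add: field_simps power2_eq_square)
  then have WV: "pdiv p 1 (W - V)" using V(2) by simp
  have "pdiv p 1 (C * W - 1 * V)"
    using C1 WV ZW by (rule pdiv_mult_cong) simp
  from pdiv_mult[OF pdiv_power[OF pdiv_p_self, of 2] this]
  have 3: "pdiv p 3 (P\<^sup>2 * (C * W - V))" by (simp add: P_def numeral_3_eq_3)
  have "C * G (p - 1) x - (s * C\<^sup>2 + P\<^sup>2 * V)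
      = C * (G (p - 1) x - (s * (1 + L + L\<^sup>2 / 2) + P\<^sup>2 * W)) + (s * C) * (1 + L + L\<^sup>2 / 2 - C) + P\<^sup>2 * (C * W - V)"
    by (simp add: power2_eq_square algebra_simps)
  also have "pdiv p 3 \<dots>"
    by (rule pdiv_add[OF pdiv_add[OF pdiv_scale[OF 1 Z(1)] pdiv_scale[OF 2 Zp_mult[OF Z(2) Z(1)]]] 3])
  finally have "zp_cong p 3 (C * G (p - 1) x) (s * C\<^sup>2 + P\<^sup>2 * V)"
    using Z V(1) by (auto simp: zp_cong_iff)
  moreover have "s = (-1) ^ r'" using sg by (simp add: s_def minus_one_power_iff)
  ultimately show ?thesis by (simp add: C_def P_def x_def)
qed

lemma pdiv_fermat_nat: "\<not> p dvd c \<Longrightarrow> pdiv p 1 (1 - of_nat c ^ (p - 1))"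
  by (rule pdiv_sym, rule fermat_Zp[OF p]) (simp_all only: pdiv_of_nat_iff[OF p] Zp_of_nat not_False_eq_True)

lemma not_dvd_prime_factors:
  "\<not> p dvd 4" "\<not> p dvd 6" "\<not> p dvd 27" "\<not> p dvd 64" "\<not> p dvd 432"
proof -
  have "\<not> p dvd 2 ^ a * 3 ^ b" for a b
    using not_dvd_2_3 p by (auto simp: prime_dvd_mult_iff dest: prime_dvd_power)
  from this[of 2 0] this[of 1 1] this[of 0 3] this[of 6 0] this[of 4 3]
  show "\<not> p dvd 4" "\<not> p dvd 6" "\<not> p dvd 27" "\<not> p dvd 64" "\<not> p dvd 432" by simp_all
qed

lemma power_p_minus_3: "(a :: rat) ^ (p - 1) = a\<^sup>2 * a ^ (p - 3)"
proof -
  have "p - 1 = 2 + (p - 3)" using p3 by simp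
  then show ?thesis by (simp only: power_add)
qed

lemma square_power: "((c :: rat) ^ n)\<^sup>2 = (c * c) ^ n"
  by (simp add: power2_eq_square power_mult_distrib)

text \<open>For \<open>j = 1\<close> and \<open>j = 2\<close> alike
  \<open>1 - j * (3 - j) / 9\<close> is 7/9; the 9 is absorbed by
  \<open>3 ^ (p - 1) = 9 * 3 ^ (p - 3)\<close>, congruent to 1.\<close>

lemma G3_cong:
  "zp_cong p 3 (G3 (p - 1)) ((-1) ^ (p div 3) * 729 ^ (p - 1) + 7 * of_nat p ^ 2 * of_int (U_num (p - 3)))"
proof -
  define E where "E = euler_poly (p - 3) (1/3)"
  have ZE: "E \<in> Zp p" unfolding E_def by (intro euler_poly_Zp third_Zp)
  have U: "of_int (U_num (p - 3)) = 3 ^ (p - 3) * E"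
    unfolding E_def using p_odd p3 by (intro U_num_euler_poly) simp
  obtain r j where r: "3 * r + 1 = p * j" "j = 1 \<or> j = 2" "even r \<longleftrightarrow> even (p div 3)"
  proof -
    have "p mod 3 \<noteq> 0" using p3 p by (auto simp: prime_nat_iff dvd_eq_mod_eq_0 [symmetric])
    then consider "p mod 3 = 1" | "p mod 3 = 2" by linarith
    then show thesis
    proof cases
      case 1
      then show ?thesis by (intro that[of "p div 3" 1]) presburger+
    next
      \<comment> \<open>With \<open>p = 3 * q + 2\<close> the residue of -1/3 is
        \<open>2 * q + 1\<close>, which is odd; \<open>q\<close> is odd as well because
        \<open>p\<close> is.\<close>
      case 2
      then show ?thesis using p_odd by (intro that[of "2 * (p div 3) + 1" 2]) presburger+
    qed
  qed
  have "7 / 9 * E - 7 * of_int (U_num (p - 3)) = 7 * (1/3)\<^sup>2 * E * (1 - of_nat 3 ^ (p - 1))"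
    unfolding U power_p_minus_3 by (simp add: power2_eq_square algebra_simps)
  moreover have "pdiv p 1 (7 * (1/3)\<^sup>2 * E * (1 - of_nat 3 ^ (p - 1)))"
    using ZE third_Zp by (intro pdiv_scale pdiv_fermat_nat not_dvd_2_3 Zp_mult Zp_power) auto
  ultimately have V: "pdiv p 1 (7 / 9 * E - 7 * of_int (U_num (p - 3)))" by simp
  have "zp_cong p 3 (of_nat 27 ^ (p - 1) * G (p - 1) (-1 / of_nat 3))
    ((-1) ^ (p div 3) * (of_nat 27 ^ (p - 1))\<^sup>2 + (of_nat p)\<^sup>2 * (7 * of_int (U_num (p - 3))))"
    using r V T_quot_exp_third unfolding E_def
    by (intro scaled_G_cong[of 3 r j] not_dvd_2_3 not_dvd_prime_factors) (auto simp: power2_eq_square)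
  then show ?thesis by (simp add: G3_def square_power mult_ac)
qed

text \<open>Here \<open>j\<close> is 1 or 3 and \<open>1 - j * (4 - j) / 16\<close> is 13/16; the 16
  is absorbed by \<open>4 ^ (p - 1)\<close>. The residue of -1/4 is \<open>q\<close> or
  \<open>3 * q + 2\<close> with \<open>q = p div 4\<close>, of the same parity.\<close>

lemma G4_cong:
  "zp_cong p 3 (G4 (p - 1)) ((-1) ^ (p div 4) * 4096 ^ (p - 1) + 13 * of_nat p ^ 2 * of_int (s_num (p - 3)))"
proof -
  define E where "E = euler_poly (p - 3) (1/4)"
  have Z4: "1 / 4 \<in> Zp p" using Zp_inverse_of_nat[OF p not_dvd_prime_factors(1)] by simp
  have ZE: "E \<in> Zp p" unfolding E_def by (intro euler_poly_Zp Z4)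
  have S: "of_int (s_num (p - 3)) = 4 ^ (p - 3) * E"
    unfolding E_def by (rule s_num_euler_poly)
  obtain r j where r: "4 * r + 1 = p * j" "j = 1 \<or> j = 3" "even r \<longleftrightarrow> even (p div 4)"
  proof -
    have "p mod 4 = 1 \<or> p mod 4 = 3" using p_odd by presburger
    then consider "p mod 4 = 1" | "p mod 4 = 3" by blast
    then show thesis
    proof cases
      case 1
      then show ?thesis by (intro that[of "p div 4" 1]) presburger+
    next
      case 2
      then show ?thesis by (intro that[of "3 * (p div 4) + 2" 3]) presburger+
    qed
  qed
  have "13 / 16 * E - 13 * of_int (s_num (p - 3)) = 13 * (1/4)\<^sup>2 * E * (1 - of_nat 4 ^ (p - 1))"
    unfolding S power_p_minus_3 by (simp add: power2_eq_square algebra_simps)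
  moreover have "pdiv p 1 (13 * (1/4)\<^sup>2 * E * (1 - of_nat 4 ^ (p - 1)))"
    using ZE Z4 by (intro pdiv_scale pdiv_fermat_nat not_dvd_prime_factors Zp_mult Zp_power) auto
  ultimately have V: "pdiv p 1 (13 / 16 * E - 13 * of_int (s_num (p - 3)))" by simp
  have "zp_cong p 3 (of_nat 64 ^ (p - 1) * G (p - 1) (-1 / of_nat 4))
    ((-1) ^ (p div 4) * (of_nat 64 ^ (p - 1))\<^sup>2 + (of_nat p)\<^sup>2 * (13 * of_int (s_num (p - 3))))"
    using r V T_quot_exp_quarter unfolding E_def
    by (intro scaled_G_cong[of 4 r j] not_dvd_prime_factors) (auto simp: power2_eq_square)
  then show ?thesis by (simp add: G4_def square_power mult_ac)
qed

text \<open>Here \<open>j\<close> is 1 or 5 and \<open>1 - j * (6 - j) / 36\<close> is 31/36. By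
  Fermat \<open>E\<close> is congruent to \<open>20 * e\<close>, and 20 times 31/36 is
  155/9.\<close>

lemma G6_cong:
  "zp_cong p 3 (G6 (p - 1)) ((-1) ^ ((p - 1) div 2) * 186624 ^ (p - 1)
     + 155 / 9 * of_nat p ^ 2 * of_int (euler_num (p - 3)))"
proof -
  define E e where "E = euler_poly (p - 3) (1/6)" and "e = (of_int (euler_num (p - 3)) :: rat)"
  have Z6: "1 / 6 \<in> Zp p" using Zp_inverse_of_nat[OF p not_dvd_prime_factors(2)] by simp
  have ZE: "E \<in> Zp p" "e \<in> Zp p" unfolding E_def e_def by (auto intro: euler_poly_Zp Z6)
  have "2 * 6 ^ (p - 3) * E = (3 ^ (p - 3) + 1) * e"
    unfolding E_def e_def using p_odd p3 by (intro euler_poly_sixth) simp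
  \<comment> \<open>The preceding equation times 18, so that all exponents become
    \<open>p - 1\<close>; modulo \<open>p\<close> the right side is \<open>20 * e\<close>.\<close>
  then have eE: "6 ^ (p - 1) * E = (2 * 3 ^ (p - 1) + 18) * e"
    unfolding power_p_minus_3 by (simp add: algebra_simps)
  obtain r j where r: "6 * r + 1 = p * j" "j = 1 \<or> j = 5" "even r \<longleftrightarrow> even ((p - 1) div 2)"
  proof -
    have "p mod 3 \<noteq> 0" using p3 p by (auto simp: prime_nat_iff dvd_eq_mod_eq_0 [symmetric])
    then have "p mod 6 = 1 \<or> p mod 6 = 5" using p_odd by presburger
    then consider "p mod 6 = 1" | "p mod 6 = 5" by blast
    then show thesis
    proof cases
      case 1
      then show ?thesis by (intro that[of "p div 6" 1]) presburger+
    next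
      case 2
      then show ?thesis by (intro that[of "5 * (p div 6) + 4" 5]) presburger+
    qed
  qed
  have 1: "pdiv p 1 (31 * (1/6)\<^sup>2 * E * (1 - of_nat 6 ^ (p - 1)))"
    using ZE Z6 by (intro pdiv_scale pdiv_fermat_nat not_dvd_prime_factors Zp_mult Zp_power) auto
  have 2: "pdiv p 1 (31 * (1/6)\<^sup>2 * 2 * e * (1 - of_nat 3 ^ (p - 1)))"
    using ZE Z6 by (intro pdiv_scale pdiv_fermat_nat not_dvd_2_3 Zp_mult Zp_power) auto
  have "31 / 36 * E - 155 / 9 * e = 31 * (1/6)\<^sup>2 * E * (1 - of_nat 6 ^ (p - 1)) - 31 * (1/6)\<^sup>2 * 2 * e * (1 - of_nat 3 ^ (p - 1))"
  proof -
    have k: "31 * (1/6)\<^sup>2 = (31 / 36 :: rat)" by (simp add: power2_eq_square)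
    have "k * E * (1 - t) = k * E - k * (t * E)" for k t :: rat by (simp add: algebra_simps)
    then have f: "31 * (1/6)\<^sup>2 * E * (1 - of_nat 6 ^ (p - 1)) = 31 / 36 * E - 31 / 36 * (6 ^ (p - 1) * E)"
      unfolding k by simp
    have g: "k * E - k * 20 * e = (k * E - k * ((2 * u + 18) * e)) - k * 2 * e * (1 - u)" for k u :: rat
      by (simp add: algebra_simps)
    show ?thesis unfolding f unfolding eE k using g[of "31 / 36" "3 ^ (p - 1)"] by simp
  qed
  with pdiv_diff[OF 1 2] have V: "pdiv p 1 (31 / 36 * E - 155 / 9 * e)" by simp
  have Z9: "155 / 9 * e \<in> Zp p"
  proof -
    have "155 * (1/3)\<^sup>2 * e \<in> Zp p" using third_Zp ZE by (intro Zp_mult Zp_power) auto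
    then show ?thesis by (simp add: power2_eq_square)
  qed
  have "zp_cong p 3 (of_nat 432 ^ (p - 1) * G (p - 1) (-1 / of_nat 6))
    ((-1) ^ ((p - 1) div 2) * (of_nat 432 ^ (p - 1))\<^sup>2 + (of_nat p)\<^sup>2 * (155 / 9 * e))"
    using r V Z9 T_quot_exp_sixth unfolding E_def
    by (intro scaled_G_cong[of 6 r j] not_dvd_prime_factors) (auto simp: power2_eq_square)
  then show ?thesis by (simp add: G6_def square_power mult_ac e_def)
qed

end

theorem theorem3p4:
  shows "(\<forall>(p::nat) (x::rat) x'.
            prime p \<and> p > 3 \<and> x \<in> Zp p \<and> x' = (x - of_nat (zp_res p x)) / of_nat p \<longrightarrow>
            zp_cong p 3 (G (p - 1) x)
              ((-1) ^ zp_res p x * (1 - 2 * of_nat p * T_quot p x + 2 * of_nat p ^ 2 * T_quot p x ^ 2)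
               + of_nat p ^ 2 * (x' * (x' + 1) + 1) * euler_poly (p - 3) (-x)))
       \<and> (\<forall>p::nat. prime p \<and> p > 3 \<longrightarrow>
            zp_cong p 3 (G3 (p - 1))
              ((-1) ^ (p div 3) * 729 ^ (p - 1) + 7 * of_nat p ^ 2 * of_int (U_num (p - 3)))
          \<and> zp_cong p 3 (G6 (p - 1))
              ((-1) ^ ((p - 1) div 2) * 186624 ^ (p - 1)
               + 155 / 9 * of_nat p ^ 2 * of_int (euler_num (p - 3)))
          \<and> zp_cong p 3 (G4 (p - 1))
              ((-1) ^ (p div 4) * 4096 ^ (p - 1) + 13 * of_nat p ^ 2 * of_int (s_num (p - 3))))"
  using G_cong(1) G3_cong G4_cong G6_cong by blast

end
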